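(* Let $T_\varepsilon$, $\varepsilon\in V$, be a family of maps of the interval as described in the context, with densities $h_\varepsilon=F_\varepsilon(\hat h_\varepsilon)$ and $h=h_0$. Suppose that the density $\hat h_\varepsilon$ of the induced map $\hat T_\varepsilon$ is differentiable as a $C^0$ element, that is, there exists $\hat h^*\in C^0$ such that $$\lim_{\varepsilon\to 0}\Big\|\frac{\hat h_\varepsilon-\hat h}{\varepsilon}-\hat h^*\Big\|_{C^0}=0$$ for some $\hat h\in C^0$ (here $\hat h=\hat h_0$). Then: 1. There exists $h^*\in\mathcal B$ such that $$\lim_{\varepsilon\to 0}\Big\|\frac{h_\varepsilon-h}{\varepsilon}-h^*\Big\|_{\mathcal B}=0,$$ i.e. $h_\varepsilon$ is differentiable as an element of $\mathcal B$ with respect to $\varepsilon$. 2. In particular, if the conditions hold for some $\gamma<1$, then $$\lim_{\varepsilon\to 0}\Big\|\frac{h_\varepsilon-h}{\varepsilon}-h^*\Big\|_{1}=0,$$ where $\|\cdot\|_1$ is the $L^1$ norm. 3. The function $h^*$ is given by $$h^*=F_0(\hat h^* )+Q\hat h.$$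
   Context: Let $V$ be a neighbourhood of $0$, let $m$ be Lebesgue measure, and let primes and superscripts $(j)$ denote derivatives in the space variable $x$. Fix $\gamma>0$. $\mathcal B$ is the Banach space of continuous functions $f$ on $(0,1]$ with the norm $\|f\|_{\mathcal B}=\sup_{x\in(0,1]}|x^\gamma f(x)|$. For each $\varepsilon\in V$, $T_\varepsilon:[0,1]\to[0,1]$ is a map, non-singular with respect to $m$, with two onto branches $T_{0,\varepsilon}:[0,1/2]\to[0,1]$ and $T_{1,\varepsilon}:[1/2,1]\to[0,1]$, whose inverse branches are denoted $g_{0,\varepsilon}$ and $g_{1,\varepsilon}$ respectively. For each $i=0,1$ and $j=0,1,2$ the following partial derivatives exist and satisfy the commutation relation $\partial_\varepsilon g_{i,\varepsilon}^{(j)}=(\partial_\varepsilon g_{i,\varepsilon})^{(j)}$. $T_\varepsilon$ has a unique (up to multiplication) absolutely continuous invariant measure, not assumed to be a probability measure (it may be $\sigma$-finite), with density $h_\varepsilon$; $h=h_0$. Let $\Delta=[1/2,1]$ and let $\hat T_\varepsilon(x)=T_\varepsilon^{R_\varepsilon(x)}(x)$, $x\in\Delta$, with $R_\varepsilon(x)=\inf\{n\ge1:T_\varepsilon^n(x)\in\Delta\}$, be the first return map of $T_\varepsilon$ to $\Delta$. It is assumed that $\hat T_\varepsilon$ has a unique (up to multiplication) absolutely continuous invariant measure, with a continuous density $\hat h_\varepsilon\in C^0$. Let $\Omega$ be the set of finite sequences $\omega=10^n$, $n\in\mathbb N\cup\{0\}$, and set $g_{\omega,\varepsilon}=g_{1,\varepsilon}\circ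 g_{0,\varepsilon}^{n}$ ($n$-fold composition of $g_{0,\varepsilon}$), so that $T_\varepsilon^{n+1}\circ g_{\omega,\varepsilon}(x)=x$ for $x\in[0,1]$. The cylinder sets $[\omega]_\varepsilon=g_{\omega,\varepsilon}(\Delta)$ form a partition of $\Delta$ (mod $0$). It is assumed that, for $\omega\in\Omega$, $$\sup_{\varepsilon\in V}\sup_{x\in[0,1]}|g'_{\omega,\varepsilon}(x)|<\infty,\qquad \sup_{\varepsilon\in V}\sup_{x\in[0,1]}|\partial_\varepsilon g_{\omega,\varepsilon}(x)|<\infty,$$ and that $$\sum_{\omega}\sup_{\varepsilon\in V}\|g'_{\omega,\varepsilon}\|_{\mathcal B}<\infty,\qquad \sum_\omega\sup_{\varepsilon\in V}\|\partial_\varepsilon g_{\omega,\varepsilon}'\|_{\mathcal B}<\infty.$$ The last two assumptions need to hold only for a single $\gamma$. For $\Phi\in L^1$ define the linear operator $$F_\varepsilon(\Phi)=1_\Delta\Phi+(1-1_\Delta)\sum_{\omega\in\Omega}\Phi\circ g_{\omega,\varepsilon}\, g_{\omega,\varepsilon}'.$$ The densities are related (modulo normalization in the finite measure case) by $h_\varepsilon=F_\varepsilon(\hat h_\varepsilon)$; in the finite measure case $h^*$ is the derivative of the non-normalized density $h_\varepsilon$. Define also the operator $$Q\Phi=(1-1_\Delta)\sum_{\omega}\big(\Phi'\circ g_{\omega}\cdot a_\omega\, g_\omega'+\Phi\circ g_\omega\cdot b_\omega\big),$$ where $g_\omega=g_{\omega,0}$, $a_\omega=\partial_\varepsilon g_{\omega,\varepsilon}|_{\varepsilon=0}$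 and $b_\omega=\partial_\varepsilon g'_{\omega,\varepsilon}|_{\varepsilon=0}$; $Q\Phi$ represents $\partial_\varepsilon F_\varepsilon\Phi|_{\varepsilon=0}$.
   Formalization: Added: ĥ is C¹ on Δ (Qĥ contains ĥ'); for each ω, g'_{ω,ε} is differentiable at ε=0 in the 𝓑 norm, not just pointwise (else false: a bump of width ε moving to an interior point); the bound on ∂_ε g_{ω,ε} is uniform over ω. *)

theory Defs
  imports "HOL-Analysis.Analysis"
begin

text \<open>
  Functions on \<open>[0,1]\<close>, \<open>(0,1]\<close> or \<open>\<Delta>\<close> are total functions on the reals of which only the values on
  the relevant set matter. Norms take values in \<open>ennreal\<close>, so that an unbounded function
  has norm \<open>\<infinity>\<close> and suprema and sums of norms are always meaningful.
\<close>

definition Dlt :: "real set" where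
  "Dlt = {1/2..1}"

definition B_norm :: "real \<Rightarrow> (real \<Rightarrow> real) \<Rightarrow> ennreal" where
  "B_norm \<gamma> f = (SUP x\<in>{0<..1}. ennreal \<bar>x powr \<gamma> * f x\<bar>)"

definition B_space :: "real \<Rightarrow> (real \<Rightarrow> real) set" where
  "B_space \<gamma> = {f. continuous_on {0<..1} f \<and> B_norm \<gamma> f < \<infinity>}"

definition C0_norm :: "(real \<Rightarrow> real) \<Rightarrow> ennreal" where
  "C0_norm f = (SUP x\<in>Dlt. ennreal \<bar>f x\<bar>)"

definition L1_norm :: "(real \<Rightarrow> real) \<Rightarrow> ennreal" where
  "L1_norm f = (\<integral>\<^sup>+x\<in>{0..1}. ennreal \<bar>f x\<bar> \<partial>lebesgue)"

text \<open>Derivatives in the space variable are one-sided at the end points of the interval.\<close>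

definition deriv_on :: "real set \<Rightarrow> (real \<Rightarrow> real) \<Rightarrow> real \<Rightarrow> real" where
  "deriv_on S f x = vector_derivative f (at x within S)"

abbreviation Dx :: "(real \<Rightarrow> real) \<Rightarrow> real \<Rightarrow> real" where
  "Dx \<equiv> deriv_on {0..1}"

text \<open>Partial derivative in the parameter: \<open>Deps G \<epsilon> x\<close> is the derivative of \<open>e \<mapsto> G e x\<close> at \<open>e = \<epsilon>\<close>.\<close>

definition Deps :: "(real \<Rightarrow> real \<Rightarrow> real) \<Rightarrow> real \<Rightarrow> real \<Rightarrow> real" where
  "Deps G \<epsilon> x = deriv (\<lambda>e. G e x) \<epsilon>"

text \<open>
  A density may have infinite mass. Since it is real-valued, the measure it defines is
  \<open>\<sigma>\<close>-finite; conversely every \<open>\<sigma>\<close>-finite absolutely continuous measure has such a density.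
\<close>

definition acim_density :: "real set \<Rightarrow> (real \<Rightarrow> real) \<Rightarrow> (real \<Rightarrow> real) \<Rightarrow> bool" where
  "acim_density S f \<rho> \<longleftrightarrow>
     f \<in> lebesgue_on S \<rightarrow>\<^sub>M lebesgue_on S \<and>
     \<rho> \<in> borel_measurable (lebesgue_on S) \<and>
     (AE x in lebesgue_on S. 0 \<le> \<rho> x) \<and>
     \<not> (AE x in lebesgue_on S. \<rho> x = 0) \<and>
     distr (density (lebesgue_on S) (\<lambda>x. ennreal (\<rho> x))) (lebesgue_on S) f = density (lebesgue_on S) (\<lambda>x. ennreal (\<rho> x))"

definition unique_acim_density :: "real set \<Rightarrow> (real \<Rightarrow> real) \<Rightarrow> (real \<Rightarrow> real) \<Rightarrow> bool" where
  "unique_acim_density S f \<rho> \<longleftrightarrow>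
     acim_density S f \<rho> \<and>
     (\<forall>\<rho>'. acim_density S f \<rho>' \<longrightarrow> (\<exists>c>0. AE x in lebesgue_on S. \<rho>' x = c * \<rho> x))"

definition nonsingular :: "(real \<Rightarrow> real) \<Rightarrow> bool" where
  "nonsingular f \<longleftrightarrow>
     f \<in> lebesgue_on {0..1} \<rightarrow>\<^sub>M lebesgue_on {0..1} \<and>
     (\<forall>N\<in>null_sets (lebesgue_on {0..1}). f -` N \<inter> {0..1} \<in> null_sets (lebesgue_on {0..1}))"

text \<open>
  The infimum of the empty set of natural numbers is unspecified, so the first return map is
  set to be the identity on the null set of points that never return.
\<close>

definition return_time :: "(real \<Rightarrow> real) \<Rightarrow> real \<Rightarrow> nat" where
  "return_time f x = Inf {n. n \<ge> 1 \<and> (f ^^ n) x \<in> Dlt}"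

definition first_return :: "(real \<Rightarrow> real) \<Rightarrow> real \<Rightarrow> real" where
  "first_return f x = (if \<exists>n\<ge>1. (f ^^ n) x \<in> Dlt then (f ^^ return_time f x) x else x)"

definition branch_dom :: "nat \<Rightarrow> real set" where
  "branch_dom i = (if i = 0 then {0..1/2} else {1/2..1})"

definition inv_branch :: "(nat \<Rightarrow> real \<Rightarrow> real \<Rightarrow> real) \<Rightarrow> nat \<Rightarrow> real \<Rightarrow> real \<Rightarrow> real" where
  "inv_branch Tb i \<epsilon> = inv_into (branch_dom i) (Tb i \<epsilon>)"

text \<open>The word \<open>\<omega> = 10\<^sup>n\<close> is encoded by \<open>n\<close>, and sums over words are sums over \<open>n\<close>.\<close>

definition g_word :: "(nat \<Rightarrow> real \<Rightarrow> real \<Rightarrow> real) \<Rightarrow> nat \<Rightarrow> real \<Rightarrow> real \<Rightarrow> real" where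
  "g_word Tb n \<epsilon> = inv_branch Tb 1 \<epsilon> \<circ> (inv_branch Tb 0 \<epsilon> ^^ n)"

definition F_op :: "(nat \<Rightarrow> real \<Rightarrow> real \<Rightarrow> real) \<Rightarrow> real \<Rightarrow> (real \<Rightarrow> real) \<Rightarrow> real \<Rightarrow> real" where
  "F_op Tb \<epsilon> \<Phi> x =
     indicator Dlt x * \<Phi> x +
     (1 - indicator Dlt x) * (\<Sum>n. \<Phi> (g_word Tb n \<epsilon> x) * Dx (g_word Tb n \<epsilon>) x)"

definition a_word :: "(nat \<Rightarrow> real \<Rightarrow> real \<Rightarrow> real) \<Rightarrow> nat \<Rightarrow> real \<Rightarrow> real" where
  "a_word Tb n = Deps (g_word Tb n) 0"

definition b_word :: "(nat \<Rightarrow> real \<Rightarrow> real \<Rightarrow> real) \<Rightarrow> nat \<Rightarrow> real \<Rightarrow> real" where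
  "b_word Tb n = Deps (\<lambda>e. Dx (g_word Tb n e)) 0"

definition Q_op :: "(nat \<Rightarrow> real \<Rightarrow> real \<Rightarrow> real) \<Rightarrow> (real \<Rightarrow> real) \<Rightarrow> real \<Rightarrow> real" where
  "Q_op Tb \<Phi> x =
     (1 - indicator Dlt x) *
     (\<Sum>n. deriv_on Dlt \<Phi> (g_word Tb n 0 x) * a_word Tb n x * Dx (g_word Tb n 0) x
         + \<Phi> (g_word Tb n 0 x) * b_word Tb n x)"

text \<open>The natural domain of \<open>Q_op\<close>, in which the derivative of \<open>\<Phi>\<close> on \<open>\<Delta>\<close> occurs.\<close>

definition C1_on_Dlt :: "(real \<Rightarrow> real) \<Rightarrow> bool" where
  "C1_on_Dlt \<Phi> \<longleftrightarrow>
     (\<forall>y\<in>Dlt. \<Phi> differentiable (at y within Dlt)) \<and> continuous_on Dlt (deriv_on Dlt \<Phi>)"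

text \<open>
  \<open>T \<epsilon>\<close> is the map, \<open>Tb i \<epsilon>\<close> its two branches on the closed half intervals (which disagree at
  \<open>1/2\<close>), \<open>h \<epsilon>\<close> and \<open>hh \<epsilon>\<close> the densities of \<open>T \<epsilon>\<close> and of its first return map. The
  second space derivatives of the inverse branches are not required at \<open>0\<close>, where they do not
  exist for intermittent maps. Existence of the parameter derivatives of the composed branches
  \<open>g_word\<close> is a separate assumption because it does not follow from the existence of the
  partial derivatives of the branches. The bound on these derivatives is uniform over words;
  \<open>h \<epsilon>\<close> is the non-normalized density.
\<close>

locale map_family =
  fixes V :: "real set"
    and \<gamma> :: real
    and T :: "real \<Rightarrow> real \<Rightarrow> real"
    and Tb :: "nat \<Rightarrow> real \<Rightarrow> real \<Rightarrow> real"
    and h hh :: "real \<Rightarrow> real \<Rightarrow> real"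
  assumes nbhd: "open V" "0 \<in> V"
    and gamma_pos: "\<gamma> > 0"
    and nonsing: "\<And>\<epsilon>. \<epsilon> \<in> V \<Longrightarrow> nonsingular (T \<epsilon>)"
    and onto_branches: "\<And>\<epsilon> i. \<epsilon> \<in> V \<Longrightarrow> i \<in> {0,1} \<Longrightarrow> bij_betw (Tb i \<epsilon>) (branch_dom i) {0..1}"
    and T_left: "\<And>\<epsilon> x. \<epsilon> \<in> V \<Longrightarrow> 0 \<le> x \<Longrightarrow> x < 1/2 \<Longrightarrow> T \<epsilon> x = Tb 0 \<epsilon> x"
    and T_right: "\<And>\<epsilon> x. \<epsilon> \<in> V \<Longrightarrow> 1/2 < x \<Longrightarrow> x \<le> 1 \<Longrightarrow> T \<epsilon> x = Tb 1 \<epsilon> x"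
    and T_half: "\<And>\<epsilon>. \<epsilon> \<in> V \<Longrightarrow> T \<epsilon> (1/2) \<in> {Tb 0 \<epsilon> (1/2), Tb 1 \<epsilon> (1/2)}"
    and g_diff: "\<And>\<epsilon> i x. \<epsilon> \<in> V \<Longrightarrow> i \<in> {0,1} \<Longrightarrow> x \<in> {0..1} \<Longrightarrow>
        inv_branch Tb i \<epsilon> differentiable (at x within {0..1})"
    and g_diff2: "\<And>\<epsilon> i x. \<epsilon> \<in> V \<Longrightarrow> i \<in> {0,1} \<Longrightarrow> x \<in> {0<..1} \<Longrightarrow>
        Dx (inv_branch Tb i \<epsilon>) differentiable (at x within {0..1})"
    and g_eps_diff0: "\<And>\<epsilon> i x. \<epsilon> \<in> V \<Longrightarrow> i \<in> {0,1} \<Longrightarrow> x \<in> {0..1} \<Longrightarrow>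
        (\<lambda>e. inv_branch Tb i e x) differentiable (at \<epsilon>)"
    and g_eps_diff: "\<And>\<epsilon> i j x. \<epsilon> \<in> V \<Longrightarrow> i \<in> {0,1} \<Longrightarrow> j \<in> {1,2} \<Longrightarrow> x \<in> {0<..1} \<Longrightarrow>
        (\<lambda>e. (Dx ^^ j) (inv_branch Tb i e) x) differentiable (at \<epsilon>)"
    and eps_g_diff: "\<And>\<epsilon> i j x. \<epsilon> \<in> V \<Longrightarrow> i \<in> {0,1} \<Longrightarrow> j \<in> {0,1} \<Longrightarrow> x \<in> {0<..1} \<Longrightarrow>
        (Dx ^^ j) (Deps (inv_branch Tb i) \<epsilon>) differentiable (at x within {0..1})"
    and commute: "\<And>\<epsilon> i j x. \<epsilon> \<in> V \<Longrightarrow> i \<in> {0,1} \<Longrightarrow> j \<in> {1,2} \<Longrightarrow> x \<in> {0<..1} \<Longrightarrow>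
        Deps (\<lambda>e. (Dx ^^ j) (inv_branch Tb i e)) \<epsilon> x = (Dx ^^ j) (Deps (inv_branch Tb i) \<epsilon>) x"
    and cyl_cover: "\<And>\<epsilon>. \<epsilon> \<in> V \<Longrightarrow> negligible (Dlt - (\<Union>n. g_word Tb n \<epsilon> ` Dlt))"
    and cyl_disj: "\<And>\<epsilon> m n. \<epsilon> \<in> V \<Longrightarrow> m \<noteq> n \<Longrightarrow>
        negligible (g_word Tb m \<epsilon> ` Dlt \<inter> g_word Tb n \<epsilon> ` Dlt)"
    and hh_density: "\<And>\<epsilon>. \<epsilon> \<in> V \<Longrightarrow> unique_acim_density Dlt (first_return (T \<epsilon>)) (hh \<epsilon>)"
    and hh_cont: "\<And>\<epsilon>. \<epsilon> \<in> V \<Longrightarrow> continuous_on Dlt (hh \<epsilon>)"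
    and h_density: "\<And>\<epsilon>. \<epsilon> \<in> V \<Longrightarrow> unique_acim_density {0..1} (T \<epsilon>) (h \<epsilon>)"
    and h_eq: "\<And>\<epsilon> x. \<epsilon> \<in> V \<Longrightarrow> x \<in> {0<..1} \<Longrightarrow> h \<epsilon> x = F_op Tb \<epsilon> (hh \<epsilon>) x"
    and gw_eps_diff: "\<And>\<epsilon> n x. \<epsilon> \<in> V \<Longrightarrow> x \<in> {0..1} \<Longrightarrow>
        (\<lambda>e. g_word Tb n e x) differentiable (at \<epsilon>)"
    and gw'_eps_diff: "\<And>\<epsilon> n x. \<epsilon> \<in> V \<Longrightarrow> x \<in> {0<..1} \<Longrightarrow>
        (\<lambda>e. Dx (g_word Tb n e) x) differentiable (at \<epsilon>)"
    and gw'_bdd: "\<And>n. (SUP \<epsilon>\<in>V. SUP x\<in>{0..1}. ennreal \<bar>Dx (g_word Tb n \<epsilon>) x\<bar>) < \<infinity>"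
    and eps_gw_bdd: "(SUP n. SUP \<epsilon>\<in>V. SUP x\<in>{0..1}. ennreal \<bar>Deps (g_word Tb n) \<epsilon> x\<bar>) < \<infinity>"
    and gw'_B: "\<And>\<epsilon> n. \<epsilon> \<in> V \<Longrightarrow> Dx (g_word Tb n \<epsilon>) \<in> B_space \<gamma>"
    and eps_gw'_B: "\<And>\<epsilon> n. \<epsilon> \<in> V \<Longrightarrow> Deps (\<lambda>e. Dx (g_word Tb n e)) \<epsilon> \<in> B_space \<gamma>"
    and gw'_sum: "(\<Sum>n. SUP \<epsilon>\<in>V. B_norm \<gamma> (Dx (g_word Tb n \<epsilon>))) < \<infinity>"
    and eps_gw'_sum: "(\<Sum>n. SUP \<epsilon>\<in>V. B_norm \<gamma> (Deps (\<lambda>e. Dx (g_word Tb n e)) \<epsilon>)) < \<infinity>"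
    \<comment> \<open>at \<open>\<epsilon> = 0\<close> the derivative of \<open>\<epsilon> \<mapsto> g'\<^sub>\<omega>\<^sub>,\<^sub>\<epsilon>\<close> is taken in the Banach space, not just pointwise\<close>
    and gw'_diff_B: "\<And>n. ((\<lambda>\<epsilon>. B_norm \<gamma> (\<lambda>x.
          (Dx (g_word Tb n \<epsilon>) x - Dx (g_word Tb n 0) x) / \<epsilon> - b_word Tb n x)) \<longlongrightarrow> 0) (at 0)"

end

theory Submission
  imports Defs
begin

text \<open>
  The response of \<open>h \<epsilon> = F (hh \<epsilon>)\<close> is computed word by word. With \<open>u \<epsilon> = hh \<epsilon> \<circ> g\<close> and \<open>v \<epsilon> = g'\<close> for
  the branch \<open>g\<close> of a word, the product rule splits the error of the difference quotient of \<open>u v\<close> into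
  products of a factor that tends to \<open>0\<close> and a bounded one; the factor
  \<open>(g \<epsilon> - g 0) / \<epsilon> - a\<close> is controlled away from \<open>x = 0\<close> by integrating the convergence of its derivative,
  and near \<open>0\<close> by the weight, since \<open>g'\<close> is bounded. The summable majorants of the weighted derivatives
  then allow the limit to be taken under the sum, uniformly in \<open>x\<close>.

  The space \<open>B_space \<gamma>\<close> requires continuity, and \<open>F\<close> glues two different formulas at \<open>1/2\<close>. That they
  agree there follows from invariance of the density under the map. Continuity of the response is then
  inherited from that of the densities, as a locally uniform limit.
\<close>

subsection \<open>Weighted uniform limits\<close>

text \<open>Two demands compete. The error of one word must tend to \<open>0\<close>, and there the
  constants may depend on the word, as the bound on \<open>g'\<close> does. The errors of all words
  together need a summable majorant, and this may use only the weighted bounds \<open>c n\<close>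
  and a Lipschitz constant of \<open>g\<close> in \<epsilon> common to all words; this is the role
  of the bound on the parameter derivatives of \<open>g\<close> that is uniform over words. The two
  demands are met separately and combined in a dominated passage to the limit. The weight
  \<open>x powr \<gamma>\<close> can be spent only once in each product. In the term with
  \<open>((g \<epsilon> - g 0) / \<epsilon> - a) * g'\<close> it goes to the first factor, whose
  uniform convergence is known only with the weight, so \<open>g'\<close> has to be bounded without
  it. Matching at \<open>1/2\<close> concerns values at a point, whereas invariance speaks of
  measures; averages over shrinking segments recover the values.\<close>

lemma B_norm_le_iff:
  assumes "0 \<le> c"
  shows "B_norm \<gamma> f \<le> ennreal c \<longleftrightarrow> (\<forall>x\<in>{0<..1}. x powr \<gamma> * \<bar>f x\<bar> \<le> c)"
  using assms by (auto simp: B_norm_def SUP_le_iff abs_mult ennreal_le_iff)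

lemma C0_norm_le_iff:
  assumes "0 \<le> c"
  shows "C0_norm f \<le> ennreal c \<longleftrightarrow> (\<forall>x\<in>Dlt. \<bar>f x\<bar> \<le> c)"
  using assms by (auto simp: C0_norm_def SUP_le_iff ennreal_le_iff)

lemma tendsto_0_ennreal_iff:
  fixes f :: "'a \<Rightarrow> ennreal"
  shows "(f \<longlongrightarrow> 0) F \<longleftrightarrow> (\<forall>e>0. \<forall>\<^sub>F x in F. f x \<le> ennreal e)"
proof
  assume L: "(f \<longlongrightarrow> 0) F"
  show "\<forall>e>0. \<forall>\<^sub>F x in F. f x \<le> ennreal e"
  proof (intro allI impI)
    fix e :: real assume "0 < e"
    then have "\<forall>\<^sub>F x in F. f x < ennreal e"
      by (intro order_tendstoD(2)[OF L]) simp
    then show "\<forall>\<^sub>F x in F. f x \<le> ennreal e"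
      by (rule eventually_mono) simp
  qed
next
  assume R: "\<forall>e>0. \<forall>\<^sub>F x in F. f x \<le> ennreal e"
  show "(f \<longlongrightarrow> 0) F"
  proof (rule order_tendstoI)
    fix a :: ennreal assume "0 < a"
    \<comment> \<open>The threshold \<open>a\<close> may be \<open>\<infinity>\<close>; any
      \<open>b < a\<close> is finite and hence comes from a real.\<close>
    then obtain b where b: "0 < b" "b < a" using dense by blast
    define e where "e = enn2real b"
    have be: "b = ennreal e" using b unfolding e_def
      using order_less_le_trans[OF b(2) top_greatest] by simp
    then have "0 < e" using b by simp
    with R have "\<forall>\<^sub>F x in F. f x \<le> ennreal e" by blast
    then show "\<forall>\<^sub>F x in F. f x < a"
      by (rule eventually_mono) (use b be in auto)
  qed simp
qed

text \<open>Passes from the \<open>ennreal\<close> norm to real estimates, where the theory of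
  \<open>uniform_limit\<close> applies. Halving \<open>e\<close> reconciles the strict inequality of
  \<open>uniform_limit\<close> with the non-strict one of a supremum.\<close>

lemma B_norm_tendsto_0_iff:
  "((\<lambda>t. B_norm \<gamma> (f t)) \<longlongrightarrow> 0) F \<longleftrightarrow>
     uniform_limit {0<..1} (\<lambda>t x. x powr \<gamma> * f t x) (\<lambda>x. 0) F"
proof -
  have "uniform_limit {0<..1} (\<lambda>t x. x powr \<gamma> * f t x) (\<lambda>x. 0) F \<longleftrightarrow>
      (\<forall>e>0. \<forall>\<^sub>F t in F. \<forall>x\<in>{0<..1}. x powr \<gamma> * \<bar>f t x\<bar> \<le> e)"
  proof (intro iffI allI impI uniform_limitI)
    fix e :: real assume "0 < e" "uniform_limit {0<..1} (\<lambda>t x. x powr \<gamma> * f t x) (\<lambda>x. 0) F"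
    from uniform_limitD[OF this(2,1)]
    show "\<forall>\<^sub>F t in F. \<forall>x\<in>{0<..1}. x powr \<gamma> * \<bar>f t x\<bar> \<le> e"
      by (rule eventually_mono) (auto simp: abs_mult less_imp_le)
  next
    fix e :: real assume e: "0 < e"
      and R: "\<forall>e>0. \<forall>\<^sub>F t in F. \<forall>x\<in>{0<..1}. x powr \<gamma> * \<bar>f t x\<bar> \<le> e"
    from e have "0 < e / 2" by simp
    with R have "\<forall>\<^sub>F t in F. \<forall>x\<in>{0<..1}. x powr \<gamma> * \<bar>f t x\<bar> \<le> e / 2" by blast
    then show "\<forall>\<^sub>F t in F. \<forall>x\<in>{0<..1}. dist (x powr \<gamma> * f t x) 0 < e"
      by (rule eventually_mono) (use e in \<open>auto simp: abs_mult intro: le_less_trans\<close>)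
  qed
  moreover have "((\<lambda>t. B_norm \<gamma> (f t)) \<longlongrightarrow> 0) F \<longleftrightarrow>
      (\<forall>e>0. \<forall>\<^sub>F t in F. \<forall>x\<in>{0<..1}. x powr \<gamma> * \<bar>f t x\<bar> \<le> e)"
    unfolding tendsto_0_ennreal_iff by (simp add: B_norm_le_iff)
  ultimately show ?thesis by simp
qed

lemma eventually_prod_principal:
  "eventually P (F \<times>\<^sub>F principal S) \<longleftrightarrow> (\<forall>\<^sub>F t in F. \<forall>x\<in>S. P (t, x))"
proof
  assume "eventually P (F \<times>\<^sub>F principal S)"
  then obtain Pf Pg where "eventually Pf F" "\<forall>x\<in>S. Pg x" "\<And>x y. Pf x \<Longrightarrow> Pg y \<Longrightarrow> P (x, y)"
    by (auto simp: eventually_prod_filter eventually_principal)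
  then show "\<forall>\<^sub>F t in F. \<forall>x\<in>S. P (t, x)" by (auto elim: eventually_mono)
next
  assume "\<forall>\<^sub>F t in F. \<forall>x\<in>S. P (t, x)"
  then show "eventually P (F \<times>\<^sub>F principal S)"
    unfolding eventually_prod_filter eventually_principal
    by (intro exI[of _ "\<lambda>t. \<forall>x\<in>S. P (t, x)"] exI[of _ "\<lambda>x. x \<in> S"]) auto
qed

text \<open>Uniformity in \<open>x\<close> becomes part of the filter, so theorems about limits
  along an arbitrary filter yield uniform statements.\<close>

lemma uniform_limit_0_prod_filter:
  fixes f :: "'a \<Rightarrow> 'b \<Rightarrow> real"
  shows "uniform_limit S f (\<lambda>x. 0) F \<longleftrightarrow> ((\<lambda>(t, x). f t x) \<longlongrightarrow> 0) (F \<times>\<^sub>F principal S)"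
  by (simp add: uniform_limit_iff tendsto_iff eventually_prod_principal case_prod_beta)

text \<open>Tannery's theorem on the product filter: termwise limits pass through the series because
  the majorant \<open>c\<close> depends on neither \<open>t\<close> nor \<open>x\<close>. That
  theorem needs a nontrivial filter; for empty \<open>S\<close> or trivial \<open>F\<close> the
  claim is vacuous.\<close>

lemma uniform_limit_suminf_0:
  fixes f :: "nat \<Rightarrow> 'a \<Rightarrow> 'b \<Rightarrow> real"
  assumes lim: "\<And>n. uniform_limit S (f n) (\<lambda>x. 0) F"
    and bound: "\<forall>\<^sub>F t in F. \<forall>x\<in>S. \<forall>n. \<bar>f n t x\<bar> \<le> c n"
    and "summable c"
  shows "uniform_limit S (\<lambda>t x. \<Sum>n. f n t x) (\<lambda>x. 0) F"
proof (cases "F \<times>\<^sub>F principal S = bot")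
  case True
  then show ?thesis by (simp add: uniform_limit_0_prod_filter case_prod_beta)
next
  case False
  have "\<forall>\<^sub>F p in F \<times>\<^sub>F principal S. \<forall>n. norm ((\<lambda>(t, x). f n t x) p) \<le> c n"
    using bound by (simp add: eventually_prod_principal)
  then have "\<forall>\<^sub>F (n, p) in at_top \<times>\<^sub>F (F \<times>\<^sub>F principal S). norm ((\<lambda>(t, x). f n t x) p) \<le> c n"
    unfolding eventually_prod_filter
    by (intro exI[of _ "\<lambda>n. True"] exI[of _ "\<lambda>p. \<forall>n. norm ((\<lambda>(t, x). f n t x) p) \<le> c n"]) auto
  from tannerys_theorem[OF _ this \<open>summable c\<close> False, of "\<lambda>n. 0"] lim
  show ?thesis unfolding uniform_limit_0_prod_filter case_prod_beta by simp
qed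

lemma ennreal_summable_majorant:
  fixes u :: "nat \<Rightarrow> ennreal"
  assumes "(\<Sum>n. u n) < \<infinity>"
  obtains c where "summable c" "\<And>n. 0 \<le> c n" "\<And>n. u n = ennreal (c n)"
proof
  have "u n < \<infinity>" for n
    using assms by (metis ennreal_suminf_lessD infinity_ennreal_def)
  then show u: "\<And>n. u n = ennreal (enn2real (u n))" by simp
  show "\<And>n. 0 \<le> enn2real (u n)" by simp
  show "summable (\<lambda>n. enn2real (u n))"
    by (rule summable_suminf_not_top) (use assms u in auto)
qed

text \<open>The constant is the integral of \<open>x powr - \<gamma>\<close> over the unit interval,
  finite since \<open>\<gamma> < 1\<close>. Pointwise \<open>\<bar>f x\<bar>\<close> is at most the
  norm times this function, except at the null point \<open>0\<close>, which the norm
  ignores.\<close>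

lemma L1_norm_le_B_norm:
  assumes "\<gamma> < 1"
  shows "L1_norm f \<le> B_norm \<gamma> f * ennreal (1 / (1 - \<gamma>))"
proof -
  have I: "(\<integral>\<^sup>+x. ennreal (x powr - \<gamma>) * indicator {0..1} x \<partial>lebesgue) = ennreal (1 / (1 - \<gamma>))"
    using nn_integral_has_integral_lebesgue[OF _ has_integral_powr_from_0[of "-\<gamma>" 1]] assms
    by (simp add: nn_integral_completion mult.commute ennreal_mult' ennreal_indicator[symmetric]
        add.commute)
  have "L1_norm f \<le> (\<integral>\<^sup>+x. B_norm \<gamma> f * (ennreal (x powr - \<gamma>) * indicator {0..1} x) \<partial>lebesgue)"
    unfolding L1_norm_def
  proof (rule nn_integral_mono_AE)
    have "AE x in lebesgue. x \<noteq> (0::real)"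
      by (rule AE_I'[of "{0}"]) (auto simp: negligible_iff_null_sets[symmetric])
    then show "AE x in lebesgue. ennreal \<bar>f x\<bar> * indicator {0..1} x
        \<le> B_norm \<gamma> f * (ennreal (x powr - \<gamma>) * indicator {0..1} x)"
    proof (rule AE_mp, intro AE_I2 impI)
      fix x :: real assume "x \<noteq> 0"
      show "ennreal \<bar>f x\<bar> * indicator {0..1} x
        \<le> B_norm \<gamma> f * (ennreal (x powr - \<gamma>) * indicator {0..1} x)"
      proof (cases "x \<in> {0..1}")
        case True
        with \<open>x \<noteq> 0\<close> have x: "x \<in> {0<..1}" by auto
        have "ennreal \<bar>f x\<bar> = ennreal \<bar>x powr \<gamma> * f x\<bar> * ennreal (x powr - \<gamma>)"
          using x by (simp add: ennreal_mult'[symmetric] abs_mult powr_minus field_simps)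
        also have "\<dots> \<le> B_norm \<gamma> f * ennreal (x powr - \<gamma>)"
          unfolding B_norm_def using x by (intro mult_right_mono SUP_upper) auto
        finally show ?thesis using True by simp
      qed simp
    qed
  qed
  also have "\<dots> = B_norm \<gamma> f * ennreal (1 / (1 - \<gamma>))"
  proof (subst nn_integral_cmult)
    have "(\<lambda>x::real. ennreal (x powr - \<gamma>) * indicator {0..1} x) \<in> borel_measurable lborel"
      by measurable
    then show "(\<lambda>x::real. ennreal (x powr - \<gamma>) * indicator {0..1} x) \<in> borel_measurable lebesgue"
      by (rule measurable_completion)
  qed (simp add: I)
  finally show ?thesis .
qed

section \<open>Functions of class \<open>C1\<close> on the compact interval
  \<open>Dlt\<close>\<close>

lemma C1_on_Dlt_deriv:
  assumes "C1_on_Dlt \<Phi>" "y \<in> Dlt"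
  shows "(\<Phi> has_real_derivative deriv_on Dlt \<Phi> y) (at y within Dlt)"
proof -
  have "\<Phi> differentiable (at y within Dlt)" using assms by (auto simp: C1_on_Dlt_def)
  then show ?thesis
    unfolding deriv_on_def has_real_derivative_iff_has_vector_derivative
    by (simp add: vector_derivative_works)
qed

lemma C1_on_Dlt_continuous_deriv:
  assumes "C1_on_Dlt \<Phi>"
  shows "continuous_on Dlt (deriv_on Dlt \<Phi>)"
  using assms by (simp add: C1_on_Dlt_def)

lemma continuous_on_Dlt_bounded:
  fixes f :: "real \<Rightarrow> real"
  assumes "continuous_on Dlt f"
  obtains M where "0 < M" "\<And>y. y \<in> Dlt \<Longrightarrow> \<bar>f y\<bar> \<le> M"
proof -
  have "compact (f ` Dlt)"
    using assms by (intro compact_continuous_image) (auto simp: Dlt_def)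
  then have "bounded (f ` Dlt)" by (rule compact_imp_bounded)
  then obtain M where "0 < M" "\<forall>z\<in>f ` Dlt. norm z \<le> M" unfolding bounded_pos by blast
  with that[of M] show ?thesis by simp
qed

text \<open>The mean value theorem is applied to
  \<open>\<lambda>w. \<Phi> w - deriv_on Dlt \<Phi> z * w\<close>, whose derivative is small by
  uniform continuity of the derivative of \<open>\<Phi>\<close> on the compact \<open>Dlt\<close>.
  Thus \<open>d\<close> does not depend on the base point \<open>z\<close>, which later runs over
  \<open>g_word Tb n 0 x\<close> for all \<open>x\<close> and all words.\<close>

lemma C1_on_Dlt_uniformly_differentiable:
  assumes C1: "C1_on_Dlt \<Phi>" and "0 < e"
  obtains d where "0 < d" "\<And>y z. y \<in> Dlt \<Longrightarrow> z \<in> Dlt \<Longrightarrow> \<bar>y - z\<bar> < d \<Longrightarrow>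
    \<bar>\<Phi> y - \<Phi> z - deriv_on Dlt \<Phi> z * (y - z)\<bar> \<le> e * \<bar>y - z\<bar>"
proof -
  have "uniformly_continuous_on Dlt (deriv_on Dlt \<Phi>)"
    using C1 by (intro compact_uniformly_continuous) (auto simp: C1_on_Dlt_def Dlt_def)
  then obtain d where d: "0 < d" "\<And>y z. y \<in> Dlt \<Longrightarrow> z \<in> Dlt \<Longrightarrow> \<bar>y - z\<bar> < d \<Longrightarrow>
      \<bar>deriv_on Dlt \<Phi> y - deriv_on Dlt \<Phi> z\<bar> < e"
    using \<open>0 < e\<close> unfolding uniformly_continuous_on_def dist_real_def by metis
  show ?thesis
  proof
    fix y z assume yz: "y \<in> Dlt" "z \<in> Dlt" "\<bar>y - z\<bar> < d"
    let ?S = "closed_segment z y"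
    have S: "?S \<subseteq> Dlt" using yz
      by (simp add: Dlt_def closed_segment_eq_real_ivl)
    have "norm ((\<Phi> y - deriv_on Dlt \<Phi> z * y) - (\<Phi> z - deriv_on Dlt \<Phi> z * z)) \<le> e * norm (y - z)"
    proof (rule field_differentiable_bound[of ?S "\<lambda>w. \<Phi> w - deriv_on Dlt \<Phi> z * w"
          "\<lambda>w. deriv_on Dlt \<Phi> w - deriv_on Dlt \<Phi> z"])
      fix w assume w: "w \<in> ?S"
      show "((\<lambda>w. \<Phi> w - deriv_on Dlt \<Phi> z * w) has_field_derivative
          deriv_on Dlt \<Phi> w - deriv_on Dlt \<Phi> z) (at w within ?S)"
        by (rule derivative_eq_intros has_field_derivative_subset[OF C1_on_Dlt_deriv[OF C1] S]
            | use w S in force)+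
      have "\<bar>w - z\<bar> < d" using w yz(3)
        by (auto simp: closed_segment_eq_real_ivl split: if_splits)
      then show "norm (deriv_on Dlt \<Phi> w - deriv_on Dlt \<Phi> z) \<le> e"
        using d(2)[of w z] w S yz by force
    qed auto
    then show "\<bar>\<Phi> y - \<Phi> z - deriv_on Dlt \<Phi> z * (y - z)\<bar> \<le> e * \<bar>y - z\<bar>"
      by (simp add: algebra_simps)
  qed (rule d(1))
qed

text \<open>Mean value theorem in the parameter with \<open>x\<close> frozen. It serves both for
  \<open>g_word\<close> and for its space derivative, so \<open>G\<close> is arbitrary and
  \<open>K\<close> may depend on \<open>x\<close>.\<close>

lemma Deps_lipschitz:
  assumes V: "\<And>e. \<bar>e\<bar> < r \<Longrightarrow> (\<lambda>e. G e x) differentiable (at e)"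
    and K: "\<And>e. \<bar>e\<bar> < r \<Longrightarrow> \<bar>Deps G e x\<bar> \<le> K"
    and e: "\<bar>e\<bar> < r"
  shows "\<bar>G e x - G 0 x\<bar> \<le> K * \<bar>e\<bar>"
proof -
  have "norm (G e x - G 0 x) \<le> K * norm (e - 0)"
  proof (rule field_differentiable_bound[of "ball 0 r" "\<lambda>e. G e x" "\<lambda>e. Deps G e x"])
    fix z :: real assume "z \<in> ball 0 r"
    then have "\<bar>z\<bar> < r" by simp
    from V[OF this] have "((\<lambda>e. G e x) has_field_derivative Deps G z x) (at z)"
      unfolding Deps_def by (simp add: DERIV_deriv_iff_real_differentiable)
    then show "((\<lambda>e. G e x) has_field_derivative Deps G z x) (at z within ball 0 r)"
      by (rule has_field_derivative_at_within)
    show "norm (Deps G z x) \<le> K" using K[OF \<open>\<bar>z\<bar> < r\<close>] by simp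
  qed (use e in auto)
  then show ?thesis by simp
qed

lemma Deps_tendsto:
  assumes "(\<lambda>e. G e x) differentiable (at 0)"
  shows "((\<lambda>e. (G e x - G 0 x) / e) \<longlongrightarrow> Deps G 0 x) (at 0)"
  using assms unfolding Deps_def
  by (simp add: DERIV_deriv_iff_real_differentiable[symmetric] DERIV_def)

text \<open>The derivative of the limit \<open>a\<close> is not known, so the mean value theorem is applied to
  \<open>D t - D s\<close>, and \<open>s\<close> is sent to the limit afterwards.\<close>

lemma uniform_limit_from_derivative:
  fixes D D' :: "'a \<Rightarrow> real \<Rightarrow> real"
  assumes "F \<noteq> bot" "u \<le> v"
    and der: "\<forall>\<^sub>F t in F. \<forall>x\<in>{u..v}. (D t has_real_derivative D' t x) (at x within {u..v})"
    and lim': "uniform_limit {u..v} D' b F"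
    and lim: "\<And>x. x \<in> {u..v} \<Longrightarrow> ((\<lambda>t. D t x) \<longlongrightarrow> a x) F"
  shows "uniform_limit {u..v} D a F"
proof (rule uniform_limitI)
  fix e :: real assume e: "0 < e"
  \<comment> \<open>\<open>2 * k * (v - u)\<close> has to be at most \<open>e / 2\<close>; the
    \<open>+ 1\<close> keeps the quotient meaningful when \<open>u = v\<close>.\<close>
  define k where "k = e / (4 * (v - u + 1))"
  have k: "0 < k" "2 * k * (v - u) \<le> e / 2"
  proof -
    show "0 < k" using e \<open>u \<le> v\<close> by (simp add: k_def)
    have "2 * k * (v - u) \<le> 2 * k * (v - u + 1)" using \<open>0 < k\<close> by simp
    also have "\<dots> = e / 2" using \<open>u \<le> v\<close> by (simp add: k_def field_simps)
    finally show "2 * k * (v - u) \<le> e / 2" .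
  qed
  \<comment> \<open>A quantitative rate is needed only at the anchor \<open>v\<close>; closeness of
    the derivatives transports it to the rest of the interval.\<close>
  have "\<forall>\<^sub>F t in F. dist (D t v) (a v) < e / 4"
    using tendstoD[OF lim[of v], of "e / 4"] e \<open>u \<le> v\<close> by simp
  with der uniform_limitD[OF lim' k(1)]
  show "\<forall>\<^sub>F t in F. \<forall>x\<in>{u..v}. dist (D t x) (a x) < e"
  proof eventually_elim
    case (elim t)
    show ?case
    proof
      fix x assume x: "x \<in> {u..v}"
      have "\<forall>\<^sub>F s in F. \<bar>(D t x - D s x) - (D t v - D s v)\<bar> \<le> 2 * k * (v - u)"
        using der uniform_limitD[OF lim' k(1)]
      proof eventually_elim
        case s: (elim s)
        have "norm ((D t x - D s x) - (D t v - D s v)) \<le> 2 * k * norm (x - v)"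
        proof (rule field_differentiable_bound[of "{u..v}" "\<lambda>y. D t y - D s y"
              "\<lambda>y. D' t y - D' s y"])
          fix z assume z: "z \<in> {u..v}"
          show "((\<lambda>y. D t y - D s y) has_field_derivative D' t z - D' s z) (at z within {u..v})"
            using elim(1) s(1) z by (intro DERIV_diff) auto
          have "dist (D' t z) (b z) < k" "dist (D' s z) (b z) < k"
            using elim(2) s(2) z by auto
          then show "norm (D' t z - D' s z) \<le> 2 * k" by (simp add: dist_real_def)
        qed (use x in auto)
        also have "\<dots> \<le> 2 * k * (v - u)"
          using x k(1) by (intro mult_left_mono) auto
        finally show ?case by simp
      qed
      moreover have "((\<lambda>s. \<bar>(D t x - D s x) - (D t v - D s v)\<bar>) \<longlongrightarrow> \<bar>(D t x - a x) - (D t v - a v)\<bar>) F"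
        by (intro tendsto_intros lim) (use x \<open>u \<le> v\<close> in auto)
      ultimately have "\<bar>(D t x - a x) - (D t v - a v)\<bar> \<le> 2 * k * (v - u)"
        by (intro tendsto_upperbound[OF _ _ \<open>F \<noteq> bot\<close>])
      then show "dist (D t x) (a x) < e"
        using k(2) elim(3) e unfolding dist_real_def by linarith
    qed
  qed
qed

text \<open>Near \<open>0\<close>, where the weight degenerates, boundedness of \<open>D\<close> replaces the convergence of \<open>D'\<close>.\<close>

lemma uniform_limit_weighted_from_derivative:
  fixes D D' :: "real \<Rightarrow> real \<Rightarrow> real"
  assumes "0 < \<gamma>" "F \<noteq> bot"
    and der: "\<forall>\<^sub>F t in F. \<forall>x\<in>{0<..1}. (D t has_real_derivative D' t x) (at x within {0<..1})"
    and lim': "uniform_limit {0<..1} (\<lambda>t x. x powr \<gamma> * (D' t x - b x)) (\<lambda>x. 0) F"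
    and lim: "\<And>x. x \<in> {0<..1} \<Longrightarrow> ((\<lambda>t. D t x) \<longlongrightarrow> a x) F"
    and bound: "\<forall>\<^sub>F t in F. \<forall>x\<in>{0<..1}. \<bar>D t x\<bar> \<le> K"
  shows "uniform_limit {0<..1} (\<lambda>t x. x powr \<gamma> * (D t x - a x)) (\<lambda>x. 0) F"
proof (rule uniform_limitI)
  fix e :: real assume e: "0 < e"
  \<comment> \<open>As a pointwise limit \<open>a\<close> inherits the bound on \<open>D\<close>, so
    near \<open>0\<close> the error is at most \<open>2 * K\<close>.\<close>
  have a: "\<bar>a x\<bar> \<le> K" if "x \<in> {0<..1}" for x
    using bound that
    by (intro tendsto_upperbound[OF tendsto_rabs[OF lim[OF that]] _ \<open>F \<noteq> bot\<close>])
      (auto elim: eventually_mono)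
  have K: "0 \<le> K" using a[of 1] by simp
  \<comment> \<open>For \<open>x < d\<close> the weighted error is at most
    \<open>d powr \<gamma> * (2 * K)\<close>, which this choice makes smaller than \<open>e\<close>.
    The \<open>+ 1\<close> covers \<open>K = 0\<close>, and the cap \<open>1\<close> keeps
    \<open>{d..1}\<close> nonempty.\<close>
  define d where "d = min 1 ((e / (2 * K + 1)) powr (1 / \<gamma>))"
  have d: "0 < d" "d \<le> 1" "d powr \<gamma> \<le> e / (2 * K + 1)"
  proof -
    show "0 < d" "d \<le> 1" using e K by (auto simp: d_def)
    have "d powr \<gamma> \<le> ((e / (2 * K + 1)) powr (1 / \<gamma>)) powr \<gamma>"
      using \<open>0 < d\<close> \<open>0 < \<gamma>\<close> by (intro powr_mono2) (auto simp: d_def)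
    also have "\<dots> = e / (2 * K + 1)" using e K \<open>0 < \<gamma>\<close> by (simp add: powr_powr)
    finally show "d powr \<gamma> \<le> e / (2 * K + 1)" .
  qed
  have sub: "{d..1} \<subseteq> {0<..1}" using d by auto
  have "uniform_limit {d..1} D' b F"
  proof (rule uniform_limitI)
    fix k :: real assume k: "0 < k"
    \<comment> \<open>On \<open>{d..1}\<close> the weight is at least
      \<open>d powr \<gamma>\<close>, so weighted convergence gives unweighted convergence
      there.\<close>
    have "0 < k * d powr \<gamma>" using k d by simp
    from uniform_limitD[OF lim' this] show "\<forall>\<^sub>F t in F. \<forall>x\<in>{d..1}. dist (D' t x) (b x) < k"
    proof eventually_elim
      case (elim t)
      show ?case
      proof
        fix x assume x: "x \<in> {d..1}"
        then have "x powr \<gamma> * \<bar>D' t x - b x\<bar> < k * d powr \<gamma>"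
          using elim sub by (force simp: abs_mult)
        also have "\<dots> \<le> k * x powr \<gamma>"
          using x d k \<open>0 < \<gamma>\<close> by (intro mult_left_mono powr_mono2) auto
        finally have "x powr \<gamma> * \<bar>D' t x - b x\<bar> < x powr \<gamma> * k" by (simp add: mult.commute)
        then show "dist (D' t x) (b x) < k"
          using x d by (simp add: dist_real_def mult_less_cancel_left_pos)
      qed
    qed
  qed
  moreover have "\<forall>\<^sub>F t in F. \<forall>x\<in>{d..1}. (D t has_real_derivative D' t x) (at x within {d..1})"
    using der by eventually_elim (use sub in \<open>blast intro: has_field_derivative_subset\<close>)
  ultimately have "uniform_limit {d..1} D a F"
    using lim sub \<open>F \<noteq> bot\<close> d by (intro uniform_limit_from_derivative[of F d 1 D D' b]) auto
  from uniform_limitD[OF this e] bound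
  show "\<forall>\<^sub>F t in F. \<forall>x\<in>{0<..1}. dist (x powr \<gamma> * (D t x - a x)) 0 < e"
  proof eventually_elim
    case (elim t)
    show ?case
    proof
      fix x :: real assume x: "x \<in> {0<..1}"
      have "x powr \<gamma> * \<bar>D t x - a x\<bar> < e"
      proof (cases "d \<le> x")
        case True
        then have "\<bar>D t x - a x\<bar> < e" using elim(1) x by (auto simp: dist_real_def)
        moreover have "x powr \<gamma> \<le> 1" using x \<open>0 < \<gamma>\<close> by (intro powr_le1) auto
        ultimately show ?thesis
          using mult_right_mono[of "x powr \<gamma>" 1 "\<bar>D t x - a x\<bar>"] by simp
      next
        case False
        have "\<bar>D t x - a x\<bar> \<le> 2 * K"
          using bspec[OF elim(2) x] a[OF x] by linarith
        then have "x powr \<gamma> * \<bar>D t x - a x\<bar> \<le> d powr \<gamma> * (2 * K)"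
          using False x d \<open>0 < \<gamma>\<close> by (intro mult_mono powr_mono2) auto
        also have "\<dots> \<le> e / (2 * K + 1) * (2 * K)"
          using d(3) K by (intro mult_right_mono) auto
        also have "\<dots> < e" using e K by (simp add: field_simps)
        finally show ?thesis .
      qed
      then show "dist (x powr \<gamma> * (D t x - a x)) 0 < e" by (simp add: abs_mult)
    qed
  qed
qed

subsection \<open>Continuity of the density at the break point\<close>

text \<open>The set where \<open>f\<close> is nonnegative is closed and contains almost every point
  of the open interval, hence its whole closure. This upgrades the almost everywhere sign of a
  density to every point, end points included.\<close>

lemma continuous_nonneg_of_AE:
  fixes f \<rho> :: "real \<Rightarrow> real"
  assumes "c < d" "{c..d} \<subseteq> S" "S \<in> sets lebesgue"
    and f: "continuous_on {c..d} f"
    and ae: "AE x in lebesgue_on S. 0 \<le> \<rho> x"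
    and eq: "\<And>x. x \<in> {c<..<d} \<Longrightarrow> \<rho> x = f x"
    and x: "x \<in> {c..d}"
  shows "0 \<le> f x"
proof -
  let ?C = "{c..d} \<inter> f -` {0..}"
  have C: "closed ?C" using f by (intro continuous_closed_preimage) auto
  have "AE x in lebesgue. x \<in> S \<longrightarrow> 0 \<le> \<rho> x"
    using ae \<open>S \<in> sets lebesgue\<close> by (simp add: AE_restrict_space_iff)
  then have "AE x \<in> {c<..<d} in lebesgue. x \<in> ?C"
  proof eventually_elim
    case (elim x)
    show ?case
    proof
      assume x: "x \<in> {c<..<d}"
      then have "x \<in> {c..d}" by auto
      then show "x \<in> ?C" using elim eq[OF x] assms(2) by auto
    qed
  qed
  then have "{c<..<d} \<subseteq> ?C"
    using mem_closed_if_AE_lebesgue_open[OF open_greaterThanLessThan C, of c d] by blast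
  then have "closure {c<..<d} \<subseteq> ?C" using C by (rule closure_minimal)
  then show ?thesis using \<open>c < d\<close> x by auto
qed

text \<open>End points are null, so agreement of \<open>\<rho>\<close> and \<open>f\<close> in the
  open interval suffices. A formula valid on one side of \<open>1/2\<close> can thus be integrated
  up to \<open>1/2\<close>, whatever value the density takes there.\<close>

lemma emeasure_density_interval:
  fixes f \<rho> :: "real \<Rightarrow> real"
  assumes sub: "{c..d} \<subseteq> S" and S: "S \<in> sets lebesgue"
    and \<rho>: "\<rho> \<in> borel_measurable (lebesgue_on S)"
    and f: "continuous_on {c..d} f" and nonneg: "\<And>x. x \<in> {c..d} \<Longrightarrow> 0 \<le> f x"
    and eq: "\<And>x. x \<in> {c<..<d} \<Longrightarrow> \<rho> x = f x"
  shows "emeasure (density (lebesgue_on S) (\<lambda>x. ennreal (\<rho> x))) {c..d} = ennreal (integral {c..d} f)"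
proof -
  have cd: "{c..d} \<in> sets (lebesgue_on S)"
    using sub S by (simp add: sets_restrict_space_iff)
  have "emeasure (density (lebesgue_on S) (\<lambda>x. ennreal (\<rho> x))) {c..d}
      = (\<integral>\<^sup>+x. ennreal (\<rho> x) * indicator {c..d} x \<partial>lebesgue_on S)"
    using \<rho> cd by (intro emeasure_density) auto
  also have "\<dots> = (\<integral>\<^sup>+x. ennreal (\<rho> x) * indicator {c..d} x * indicator S x \<partial>lebesgue)"
    using S by (intro nn_integral_restrict_space) simp
  also have "\<dots> = (\<integral>\<^sup>+x. ennreal (indicator {c..d} x * f x) \<partial>lebesgue)"
  proof (rule nn_integral_cong_AE)
    have "AE x in lebesgue. x \<notin> {c, d}"
      by (rule AE_I'[of "{c, d}"]) (auto simp: negligible_iff_null_sets[symmetric])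
    then show "AE x in lebesgue. ennreal (\<rho> x) * indicator {c..d} x * indicator S x
        = ennreal (indicator {c..d} x * f x)"
      by (rule AE_mp) (use eq sub in \<open>auto intro!: AE_I2 simp: indicator_def\<close>)
  qed
  also have "\<dots> = ennreal (integral {c..d} f)"
    unfolding nn_integral_completion
    by (rule nn_integral_has_integral_lebesgue)
      (auto intro!: nonneg integrable_integral integrable_continuous_interval f)
  finally show ?thesis .
qed

text \<open>With \<open>G\<close> a primitive of \<open>f\<close>, the integral over the image of
  the segment is \<open>\<bar>G (k x) - G (k x0)\<bar>\<close>, so the limit is the modulus of the
  derivative of \<open>G \<circ> k\<close> at \<open>x0\<close>. The absolute values cover
  decreasing \<open>k\<close> and points on either side of \<open>x0\<close>, and \<open>x0\<close>
  may be an end point of the interval.\<close>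

lemma integral_image_segment_quotient:
  fixes k f :: "real \<Rightarrow> real"
  assumes x0: "x0 \<in> {a..b}"
    and k: "continuous_on {a..b} k" "inj_on k {a..b}"
    and k': "(k has_real_derivative k') (at x0 within {a..b})"
    and f: "continuous_on (k ` {a..b}) f"
    and nonneg: "\<And>y. y \<in> k ` {a..b} \<Longrightarrow> 0 \<le> f y"
  shows "((\<lambda>x. integral (k ` closed_segment x0 x) f / \<bar>x - x0\<bar>) \<longlongrightarrow> \<bar>f (k x0) * k'\<bar>) (at x0 within {a..b})"
proof -
  have img: "k ` closed_segment x y = closed_segment (k x) (k y)" if "x \<in> {a..b}" "y \<in> {a..b}" for x y
  proof (rule continuous_injective_image_segment_1)
    have "closed_segment x y \<subseteq> {a..b}" using that by (auto simp: closed_segment_eq_real_ivl)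
    then show "continuous_on (closed_segment x y) k" "inj_on k (closed_segment x y)"
      using k continuous_on_subset inj_on_subset by blast+
  qed
  define p q where "p = min (k a) (k b)" and "q = max (k a) (k b)"
  have pq: "k ` {a..b} = {p..q}"
    using img[of a b] x0
    by (auto simp: p_def q_def closed_segment_eq_real_ivl split: if_splits)
  define G where "G = (\<lambda>u. integral {p..u} f)"
  have fint: "f integrable_on {u..v}" if "{u..v} \<subseteq> {p..q}" for u v
    using that f pq by (intro integrable_continuous_interval) (auto intro: continuous_on_subset)
  have kx: "k x \<in> {p..q}" if "x \<in> {a..b}" for x
    using pq that by blast
  have G: "(G has_real_derivative f (k x0)) (at (k x0) within k ` {a..b})"
    unfolding G_def using f pq kx[OF x0] by (auto intro: integral_has_real_derivative)
  have GI: "integral {u..v} f = \<bar>G v - G u\<bar>" if "u \<in> {p..q}" "v \<in> {p..q}" "u \<le> v" for u v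
  proof -
    have "G u + integral {u..v} f = G v"
      unfolding G_def using that fint[of p v]
      by (intro Henstock_Kurzweil_Integration.integral_combine) auto
    moreover have "0 \<le> integral {u..v} f"
      using that nonneg pq by (intro integral_nonneg fint) auto
    ultimately show ?thesis by simp
  qed
  have "((G \<circ> k) has_real_derivative f (k x0) * k') (at x0 within {a..b})"
    by (rule DERIV_image_chain[OF G k'])
  then have "((\<lambda>x. \<bar>((G \<circ> k) x - (G \<circ> k) x0) / (x - x0)\<bar>) \<longlongrightarrow> \<bar>f (k x0) * k'\<bar>) (at x0 within {a..b})"
    by (intro tendsto_rabs) (simp add: has_field_derivative_iff)
  moreover have "\<forall>\<^sub>F x in at x0 within {a..b}. \<bar>((G \<circ> k) x - (G \<circ> k) x0) / (x - x0)\<bar>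
      = integral (k ` closed_segment x0 x) f / \<bar>x - x0\<bar>"
    unfolding eventually_at_filter
  proof (intro always_eventually allI impI)
    fix x assume x: "x \<in> {a..b}"
    have "integral (closed_segment (k x0) (k x)) f = \<bar>G (k x) - G (k x0)\<bar>"
      using GI[OF kx[OF x0] kx[OF x]] GI[OF kx[OF x] kx[OF x0]]
      by (auto simp: closed_segment_eq_real_ivl abs_minus_commute)
    then show "\<bar>((G \<circ> k) x - (G \<circ> k) x0) / (x - x0)\<bar>
        = integral (k ` closed_segment x0 x) f / \<bar>x - x0\<bar>"
      by (simp add: img[OF x0 x] abs_divide)
  qed
  ultimately show ?thesis by (rule Lim_transform_eventually)
qed

section \<open>Invariance of the density expressed through the inverse branches\<close>

context map_family
begin

lemma inv_branch_bij:
  assumes "\<epsilon> \<in> V" "i \<in> {0,1}"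
  shows "bij_betw (inv_branch Tb i \<epsilon>) {0..1} (branch_dom i)"
  unfolding inv_branch_def by (rule bij_betw_inv_into[OF onto_branches[OF assms]])

lemma inv_branch_continuous:
  assumes "\<epsilon> \<in> V" "i \<in> {0,1}"
  shows "continuous_on {0..1} (inv_branch Tb i \<epsilon>)"
  by (auto simp: continuous_on_eq_continuous_within
      intro!: differentiable_imp_continuous_within g_diff[OF assms])

lemma inv_branch_mem:
  assumes "\<epsilon> \<in> V" "i \<in> {0,1}" "x \<in> {0..1}"
  shows "inv_branch Tb i \<epsilon> x \<in> branch_dom i"
  using inv_branch_bij[OF assms(1,2)] assms(3) by (auto simp: bij_betw_def)

lemma inv_branch_image_interval:
  assumes "\<epsilon> \<in> V" "i \<in> {0,1}" "{u..v} \<subseteq> {0..1}" "u \<le> v"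
  obtains c d where "inv_branch Tb i \<epsilon> ` {u..v} = {c..d}"
proof -
  have "inv_branch Tb i \<epsilon> ` closed_segment u v
      = closed_segment (inv_branch Tb i \<epsilon> u) (inv_branch Tb i \<epsilon> v)"
    using assms(3,4) inv_branch_continuous[OF assms(1,2)] inv_branch_bij[OF assms(1,2)]
    by (intro continuous_injective_image_segment_1)
      (auto simp: closed_segment_eq_real_ivl bij_betw_def intro: continuous_on_subset inj_on_subset)
  then show ?thesis
    using that assms(4) by (auto simp: closed_segment_eq_real_ivl split: if_splits)
qed

text \<open>A continuous injection carries an open segment to the open segment between the images of
  its ends. Preimages of points near \<open>1/2\<close> thereby avoid \<open>1/2\<close>, where
  continuity is in question, and \<open>0\<close>, where the density may be unbounded.\<close>

lemma inv_branch_interior: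
  assumes "\<epsilon> \<in> V" "i \<in> {0,1}" "x \<in> {0<..<1}"
  shows "inv_branch Tb i \<epsilon> x \<in> interior (branch_dom i)"
proof -
  let ?g = "inv_branch Tb i \<epsilon>"
  have g: "continuous_on (closed_segment 0 1) ?g" "inj_on ?g (closed_segment 0 1)"
    using inv_branch_continuous[OF assms(1,2)] inv_branch_bij[OF assms(1,2)]
    by (auto simp: closed_segment_eq_real_ivl bij_betw_def)
  have "closed_segment (?g 0) (?g 1) = branch_dom i"
    using continuous_injective_image_segment_1[OF g] inv_branch_bij[OF assms(1,2)]
    by (simp add: closed_segment_eq_real_ivl bij_betw_def)
  moreover have "?g x \<in> open_segment (?g 0) (?g 1)"
    using continuous_injective_image_open_segment_1[OF g] assms(3)
    by (auto simp: open_segment_eq_real_ivl)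
  moreover have "open_segment (?g 0) (?g 1) \<subseteq> interior (closed_segment (?g 0) (?g 1))"
    by (intro interior_maximal segment_open_subset_closed) (simp add: open_segment_eq_real_ivl)
  ultimately show ?thesis by auto
qed

text \<open>The point \<open>1/2\<close> lies in both closed branch domains while
  \<open>T \<epsilon>\<close> takes just one value there. Any other \<open>x\<close> belongs to one
  branch domain only, and inverting that branch gives both claims.\<close>

lemma branch_image_iff:
  assumes "\<epsilon> \<in> V" "A \<subseteq> {0..1}" "x \<in> {0..1}" "x \<noteq> 1/2"
  shows "T \<epsilon> x \<in> A \<longleftrightarrow> x \<in> inv_branch Tb 0 \<epsilon> ` A \<union> inv_branch Tb 1 \<epsilon> ` A"
    and "x \<notin> inv_branch Tb 0 \<epsilon> ` A \<inter> inv_branch Tb 1 \<epsilon> ` A"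
proof -
  have g0: "inv_branch Tb 0 \<epsilon> y \<le> 1/2" and g1: "1/2 \<le> inv_branch Tb 1 \<epsilon> y" if "y \<in> A" for y
    using inv_branch_mem[OF assms(1), of 0 y] inv_branch_mem[OF assms(1), of 1 y] that assms(2)
    by (auto simp: branch_dom_def)
  have in_image: "Tb i \<epsilon> x \<in> A \<longleftrightarrow> x \<in> inv_branch Tb i \<epsilon> ` A"
    if "i \<in> {0,1}" "x \<in> branch_dom i" for i
  proof -
    have bij: "bij_betw (Tb i \<epsilon>) (branch_dom i) {0..1}" using onto_branches assms(1) that(1) .
    show ?thesis
    proof
      assume "Tb i \<epsilon> x \<in> A"
      then show "x \<in> inv_branch Tb i \<epsilon> ` A"
        unfolding inv_branch_def using bij_betw_inv_into_left[OF bij that(2)]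
        by (intro rev_image_eqI[of "Tb i \<epsilon> x"]) auto
    next
      assume "x \<in> inv_branch Tb i \<epsilon> ` A"
      then obtain y where y: "y \<in> A" "x = inv_into (branch_dom i) (Tb i \<epsilon>) y"
        by (auto simp: inv_branch_def)
      then show "Tb i \<epsilon> x \<in> A"
        using bij_betw_inv_into_right[OF bij, of y] assms(2) by auto
    qed
  qed
  show "T \<epsilon> x \<in> A \<longleftrightarrow> x \<in> inv_branch Tb 0 \<epsilon> ` A \<union> inv_branch Tb 1 \<epsilon> ` A"
  proof (cases "x < 1/2")
    case True
    have "x \<notin> inv_branch Tb 1 \<epsilon> ` A" using g1 True by force
    then show ?thesis
      using in_image[of 0] T_left[of \<epsilon> x] assms True by (auto simp: branch_dom_def)
  next
    case False
    then have "x \<notin> inv_branch Tb 0 \<epsilon> ` A" using g0 assms(4) by force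
    then show ?thesis
      using in_image[of 1] T_right[of \<epsilon> x] assms False by (auto simp: branch_dom_def)
  qed
  show "x \<notin> inv_branch Tb 0 \<epsilon> ` A \<inter> inv_branch Tb 1 \<epsilon> ` A"
    using g0 g1 assms(4) by force
qed

text \<open>Invariance equates the measure of the interval with that of its preimage, which up to
  the null point \<open>1/2\<close> is the disjoint union of the two branch images.\<close>

lemma invariant_measure_branches:
  assumes \<epsilon>: "\<epsilon> \<in> V" and uv: "{u..v} \<subseteq> {0..1}" "u \<le> v"
  defines "\<mu> \<equiv> density (lebesgue_on {0..1}) (\<lambda>x. ennreal (h \<epsilon> x))"
  shows "emeasure \<mu> {u..v} =
    emeasure \<mu> (inv_branch Tb 0 \<epsilon> ` {u..v}) + emeasure \<mu> (inv_branch Tb 1 \<epsilon> ` {u..v})"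
proof -
  let ?A = "{u..v}" and ?L = "lebesgue_on {0..1::real}"
  let ?B = "\<lambda>i. inv_branch Tb i \<epsilon> ` {u..v}"
  have acim: "acim_density {0..1} (T \<epsilon>) (h \<epsilon>)"
    using h_density[OF \<epsilon>] by (simp add: unique_acim_density_def)
  have T: "T \<epsilon> \<in> ?L \<rightarrow>\<^sub>M ?L" and inv: "distr \<mu> ?L (T \<epsilon>) = \<mu>"
    and [measurable]: "h \<epsilon> \<in> borel_measurable ?L"
    using acim by (auto simp: acim_density_def \<mu>_def)
  have sets_\<mu>: "sets \<mu> = sets ?L" and space_\<mu>: "space \<mu> = {0..1}" by (auto simp: \<mu>_def)
  have T\<mu>: "T \<epsilon> \<in> \<mu> \<rightarrow>\<^sub>M ?L" using T by (simp add: \<mu>_def)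
  have A: "?A \<in> sets ?L" using uv by (simp add: sets_restrict_space_iff)
  have B: "?B i \<in> sets \<mu>" if i: "i \<in> {0,1}" for i
  proof -
    obtain c d where cd: "?B i = {c..d}" using inv_branch_image_interval[OF \<epsilon> i uv] .
    have "?B i \<subseteq> {0..1}"
    proof (rule image_subsetI)
      fix x assume "x \<in> {u..v}"
      then have "inv_branch Tb i \<epsilon> x \<in> branch_dom i" using uv by (intro inv_branch_mem[OF \<epsilon> i]) auto
      then show "inv_branch Tb i \<epsilon> x \<in> {0..1}" by (auto simp: branch_dom_def split: if_splits)
    qed
    then show ?thesis unfolding cd sets_\<mu> by (simp add: sets_restrict_space_iff)
  qed
  have "AE x in lebesgue. x \<noteq> (1/2::real)"
    by (rule AE_I'[of "{1/2}"]) (auto simp: negligible_iff_null_sets[symmetric])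
  then have "AE x in ?L. x \<noteq> 1/2"
    by (subst AE_restrict_space_iff) (auto elim: eventually_mono)
  then have half: "AE x in \<mu>. x \<noteq> 1/2" unfolding \<mu>_def by (subst AE_density) auto
  have "emeasure \<mu> ?A = emeasure \<mu> (T \<epsilon> -` ?A \<inter> {0..1})"
    using emeasure_distr[OF T\<mu> A] by (simp add: inv space_\<mu>)
  also have "\<dots> = emeasure \<mu> (?B 0 \<union> ?B 1)"
  proof (rule emeasure_eq_AE)
    show "AE x in \<mu>. x \<in> T \<epsilon> -` ?A \<inter> {0..1} \<longleftrightarrow> x \<in> ?B 0 \<union> ?B 1"
      using half AE_space
    proof eventually_elim
      case (elim x)
      then show ?case using branch_image_iff(1)[OF \<epsilon> uv(1), of x] by (simp add: space_\<mu>)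
    qed
    show "T \<epsilon> -` ?A \<inter> {0..1} \<in> sets \<mu>" using measurable_sets[OF T\<mu> A] by (simp add: space_\<mu>)
    show "?B 0 \<union> ?B 1 \<in> sets \<mu>" using B by auto
  qed
  \<comment> \<open>The overlap can contain only \<open>1/2\<close>. Adding its zero measure permits
    \<open>emeasure_Un_Int\<close>, an identity without subtraction that holds for infinite measures
    too.\<close>
  also have "\<dots> = emeasure \<mu> (?B 0 \<union> ?B 1) + emeasure \<mu> (?B 0 \<inter> ?B 1)"
  proof -
    have "emeasure \<mu> (?B 0 \<inter> ?B 1) = emeasure \<mu> {}"
    proof (rule emeasure_eq_AE)
      show "AE x in \<mu>. x \<in> ?B 0 \<inter> ?B 1 \<longleftrightarrow> x \<in> {}"
        using half AE_space
      proof eventually_elim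
        case (elim x)
        then show ?case using branch_image_iff(2)[OF \<epsilon> uv(1), of x] by (simp add: space_\<mu>)
      qed
    qed (use B in auto)
    then show ?thesis by simp
  qed
  also have "\<dots> = emeasure \<mu> (?B 0) + emeasure \<mu> (?B 1)"
    using B by (intro emeasure_Un_Int[symmetric]) auto
  finally show ?thesis .
qed

lemma h_eq_hh:
  assumes "\<epsilon> \<in> V" "x \<in> Dlt"
  shows "h \<epsilon> x = hh \<epsilon> x"
  using h_eq[of \<epsilon> x] assms by (simp add: F_op_def Dlt_def)

text \<open>The measure of the segment between \<open>1/2\<close> and \<open>x\<close>, divided by its length, tends to
  \<open>P (1/2)\<close> from the left and to \<open>hh \<epsilon> (1/2)\<close> from the right. By invariance it equals the sum of the
  measures of two preimages that lie away from \<open>1/2\<close>, and so has a two-sided limit.\<close>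

lemma density_continuous_at_half:
  assumes \<epsilon>: "\<epsilon> \<in> V" and P: "continuous_on {0<..1/2} P"
    and hP: "\<And>x. x \<in> {0<..<1/2} \<Longrightarrow> h \<epsilon> x = P x"
  shows "P (1/2) = hh \<epsilon> (1/2)"
proof -
  define \<mu> where "\<mu> = density (lebesgue_on {0..1}) (\<lambda>x. ennreal (h \<epsilon> x))"
  let ?g = "\<lambda>i. inv_branch Tb i \<epsilon>"
  have acim: "acim_density {0..1} (T \<epsilon>) (h \<epsilon>)"
    using h_density[OF \<epsilon>] by (simp add: unique_acim_density_def)
  have hm: "h \<epsilon> \<in> borel_measurable (lebesgue_on {0..1})"
    and h0: "AE x in lebesgue_on {0..1}. 0 \<le> h \<epsilon> x"
    using acim by (auto simp: acim_density_def)
  \<comment> \<open>Starting the interval at \<open>x/2\<close> keeps it off \<open>0\<close>, and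
    nondegenerate even for \<open>x = 1/2\<close>.\<close>
  have P0: "0 \<le> P x" if "x \<in> {0<..1/2}" for x
    by (rule continuous_nonneg_of_AE[OF _ _ _ _ h0, of "x/2" "1/2"])
      (use that hP in \<open>auto intro!: continuous_on_subset[OF P]\<close>)
  have hh0: "0 \<le> hh \<epsilon> x" if "x \<in> {1/2..1}" for x
    by (rule continuous_nonneg_of_AE[OF _ _ _ _ h0, of "1/2" 1])
      (use that h_eq_hh[OF \<epsilon>] hh_cont[OF \<epsilon>] in \<open>auto simp: Dlt_def\<close>)
  have \<mu>P: "emeasure \<mu> {c..d} = ennreal (integral {c..d} P)" if "{c..d} \<subseteq> {0<..1/2}" for c d
    unfolding \<mu>_def
  proof (rule emeasure_density_interval[OF _ _ hm continuous_on_subset[OF P that]])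
    show "{c..d} \<subseteq> {0..1}" using that by force
    show "h \<epsilon> x = P x" if "x \<in> {c<..<d}" for x
    proof (rule hP)
      have "x \<in> {c..d}" "d \<in> {c..d}" using that by auto
      then have "x \<in> {0<..1/2}" "d \<in> {0<..1/2}"
        using \<open>{c..d} \<subseteq> {0<..1/2}\<close> by blast+
      then show "x \<in> {0<..<1/2}" using that by auto
    qed
  qed (use that P0 in auto)
  have \<mu>hh: "emeasure \<mu> {c..d} = ennreal (integral {c..d} (hh \<epsilon>))" if "{c..d} \<subseteq> {1/2..1}" for c d
    unfolding \<mu>_def
  proof (rule emeasure_density_interval[OF _ _ hm])
    show "{c..d} \<subseteq> {0..1}" using that by force
    show "continuous_on {c..d} (hh \<epsilon>)"
      using hh_cont[OF \<epsilon>] that by (auto simp: Dlt_def intro: continuous_on_subset)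
    show "h \<epsilon> x = hh \<epsilon> x" if "x \<in> {c<..<d}" for x
      using that \<open>{c..d} \<subseteq> {1/2..1}\<close> by (intro h_eq_hh[OF \<epsilon>]) (auto simp: Dlt_def subset_iff)
  qed (use that hh0 in auto)
  \<comment> \<open>\<open>{1/4..3/4}\<close> is a neighbourhood of \<open>1/2\<close> inside the
    open unit interval, so its preimages stay in the open halves, where the density is given by the
    continuous functions \<open>P\<close> and \<open>hh \<epsilon>\<close>.\<close>
  have g0: "?g 0 x \<in> {0<..<1/2}" if "x \<in> {1/4..3/4}" for x
    using inv_branch_interior[OF \<epsilon>, of 0 x] that by (auto simp: branch_dom_def)
  have g1: "?g 1 x \<in> {1/2<..<1}" if "x \<in> {1/4..3/4}" for x
    using inv_branch_interior[OF \<epsilon>, of 1 x] that by (auto simp: branch_dom_def)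
  have gdiff: "\<exists>k'. (?g i has_real_derivative k') (at (1/2) within {1/4..3/4})" if i: "i \<in> {0,1}" for i
  proof -
    obtain k' where "(?g i has_real_derivative k') (at (1/2) within {0..1})"
      using g_diff[OF \<epsilon> i, of "1/2"] by (auto simp: real_differentiable_def)
    then have "(?g i has_real_derivative k') (at (1/2) within {1/4..3/4})"
      by (rule has_field_derivative_subset) auto
    then show ?thesis ..
  qed
  obtain k0 where k0: "(?g 0 has_real_derivative k0) (at (1/2) within {1/4..3/4})"
    using gdiff[of 0] by auto
  obtain k1 where k1: "(?g 1 has_real_derivative k1) (at (1/2) within {1/4..3/4})"
    using gdiff[of 1] by auto
  have gc: "continuous_on {1/4..3/4} (?g i)" "inj_on (?g i) {1/4..3/4}" if "i \<in> {0,1}" for i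
    using inv_branch_continuous[OF \<epsilon> that] inv_branch_bij[OF \<epsilon> that]
    by (auto simp: bij_betw_def intro: continuous_on_subset inj_on_subset)
  \<comment> \<open>The value that the transfer operator of \<open>T \<epsilon>\<close> predicts at
    \<open>1/2\<close>: each preimage contributes its density times the modulus of the derivative of
    the inverse branch.\<close>
  define D where "D = \<bar>P (?g 0 (1/2)) * k0\<bar> + \<bar>hh \<epsilon> (?g 1 (1/2)) * k1\<bar>"
  let ?S = "closed_segment (1/2)"
  let ?W = "\<lambda>x. (integral (?g 0 ` ?S x) P + integral (?g 1 ` ?S x) (hh \<epsilon>)) / \<bar>x - 1/2\<bar>"
  have Wlim: "(?W \<longlongrightarrow> D) (at (1/2) within {1/4..3/4})"
    unfolding D_def add_divide_distrib
  proof (intro tendsto_add integral_image_segment_quotient k0 k1 gc)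
    show "continuous_on (?g 0 ` {1/4..3/4}) P"
      using g0 by (intro continuous_on_subset[OF P]) force
    show "continuous_on (?g 1 ` {1/4..3/4}) (hh \<epsilon>)"
      using g1 by (intro continuous_on_subset[OF hh_cont[OF \<epsilon>]]) (force simp: Dlt_def)
  qed (use g0 g1 P0 hh0 in force)+
  have W: "emeasure \<mu> (?S x) = ennreal (integral (?g 0 ` ?S x) P + integral (?g 1 ` ?S x) (hh \<epsilon>))"
    "0 \<le> integral (?g 0 ` ?S x) P + integral (?g 1 ` ?S x) (hh \<epsilon>)"
    if x: "x \<in> {1/4..3/4}" for x
  proof -
    obtain u v where S: "?S x = {u..v}" and uv: "u \<le> v" "{u..v} \<subseteq> {1/4..3/4}"
      using x by (intro that[of "min (1/2) x" "max (1/2) x"]) (auto simp: closed_segment_eq_real_ivl min_def max_def split: if_splits)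
    have uv': "{u..v} \<subseteq> {0..1}" using uv(2) by force
    obtain c d where cd: "?g 0 ` {u..v} = {c..d}"
      using inv_branch_image_interval[OF \<epsilon> _ uv' uv(1), of 0] by auto
    obtain c' d' where cd': "?g 1 ` {u..v} = {c'..d'}"
      using inv_branch_image_interval[OF \<epsilon> _ uv' uv(1), of 1] by auto
    have sub: "{c..d} \<subseteq> {0<..1/2}" unfolding cd[symmetric] using g0 uv by fastforce
    have sub': "{c'..d'} \<subseteq> {1/2..1}" unfolding cd'[symmetric] using g1 uv by fastforce
    have nn: "0 \<le> integral {c..d} P"
      using sub P0 by (intro integral_nonneg integrable_continuous_interval continuous_on_subset[OF P]) auto
    have nn': "0 \<le> integral {c'..d'} (hh \<epsilon>)"
      using sub' hh0
      by (intro integral_nonneg integrable_continuous_interval continuous_on_subset[OF hh_cont[OF \<epsilon>]])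
        (auto simp: Dlt_def)
    show "emeasure \<mu> (?S x) = ennreal (integral (?g 0 ` ?S x) P + integral (?g 1 ` ?S x) (hh \<epsilon>))"
      using invariant_measure_branches[OF \<epsilon> uv' uv(1)] nn nn'
      by (simp add: S cd cd' \<mu>_def[symmetric] \<mu>P[OF sub] \<mu>hh[OF sub'] del: One_nat_def)
    show "0 \<le> integral (?g 0 ` ?S x) P + integral (?g 1 ` ?S x) (hh \<epsilon>)"
      using nn nn' by (simp add: S cd cd' del: One_nat_def)
  qed
  \<comment> \<open>With the identity in place of a branch, the quotient lemma recovers
    \<open>f (1/2)\<close> as the limit of averages over shrinking segments. By \<open>W\<close>
    these averages equal \<open>?W\<close>, whose limit \<open>D\<close> is the same from both
    sides.\<close>
  have one_sided: "f (1/2) = D"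
    if ab: "a < b" "{a..b} \<subseteq> {1/4..3/4}" "1/2 \<in> {a..b}" and f: "continuous_on {a..b} f"
      and f0: "\<And>x. x \<in> {a..b} \<Longrightarrow> 0 \<le> f x"
      and \<mu>f: "\<And>c d. {c..d} \<subseteq> {a..b} \<Longrightarrow> emeasure \<mu> {c..d} = ennreal (integral {c..d} f)"
    for a b f
  proof -
    have nt: "at (1/2) within {a..b} \<noteq> bot"
      using ab by (simp add: trivial_limit_within)
    have "((\<lambda>x. integral ((\<lambda>x. x) ` ?S x) f / \<bar>x - 1/2\<bar>) \<longlongrightarrow> \<bar>f (1/2) * 1\<bar>) (at (1/2) within {a..b})"
      using ab f f0 by (intro integral_image_segment_quotient) auto
    moreover have "\<forall>\<^sub>F x in at (1/2) within {a..b}. integral ((\<lambda>x. x) ` ?S x) f / \<bar>x - 1/2\<bar> = ?W x"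
      unfolding eventually_at_filter
    proof (intro always_eventually allI impI)
      fix x assume x: "x \<in> {a..b}"
      obtain u v where S: "?S x = {u..v}" and uv: "{u..v} \<subseteq> {a..b}"
        using x ab(3)
        by (intro that[of "min (1/2) x" "max (1/2) x"]) (auto simp: closed_segment_eq_real_ivl min_def max_def split: if_splits)
      have "0 \<le> integral {u..v} f"
        using uv f0 by (intro integral_nonneg integrable_continuous_interval continuous_on_subset[OF f]) auto
      then have "integral {u..v} f = integral (?g 0 ` ?S x) P + integral (?g 1 ` ?S x) (hh \<epsilon>)"
        using W[of x] x ab(2) \<mu>f[OF uv] S by (auto simp: subset_iff)
      then show "integral ((\<lambda>x. x) ` ?S x) f / \<bar>x - 1/2\<bar> = ?W x" by (simp add: S)
    qed
    ultimately have "(?W \<longlongrightarrow> \<bar>f (1/2) * 1\<bar>) (at (1/2) within {a..b})"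
      by (rule Lim_transform_eventually)
    moreover have "(?W \<longlongrightarrow> D) (at (1/2) within {a..b})"
      using Wlim ab(2) by (rule tendsto_within_subset)
    ultimately have "\<bar>f (1/2) * 1\<bar> = D" by (rule tendsto_unique[OF nt])
    then show ?thesis using f0[OF ab(3)] by simp
  qed
  have "P (1/2) = D"
  proof (rule one_sided[of "1/4" "1/2"])
    show "continuous_on {1/4..1/2} P" by (rule continuous_on_subset[OF P]) auto
    show "emeasure \<mu> {c..d} = ennreal (integral {c..d} P)" if "{c..d} \<subseteq> {1/4..1/2}" for c d
      using that by (intro \<mu>P) force
  qed (auto intro: P0)
  moreover have "hh \<epsilon> (1/2) = D"
  proof (rule one_sided[of "1/2" "3/4"])
    show "continuous_on {1/2..3/4} (hh \<epsilon>)"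
      by (rule continuous_on_subset[OF hh_cont[OF \<epsilon>]]) (auto simp: Dlt_def)
    show "emeasure \<mu> {c..d} = ennreal (integral {c..d} (hh \<epsilon>))" if "{c..d} \<subseteq> {1/2..3/4}" for c d
      using that by (intro \<mu>hh) force
  qed (auto intro: hh0)
  ultimately show ?thesis by simp
qed

end

subsection \<open>Sums over words\<close>

lemma weighted_suminf_bound:
  fixes u :: "nat \<Rightarrow> real"
  assumes "0 < w" "\<And>n. w * \<bar>u n\<bar> \<le> c n" "summable c"
  shows "summable u" "w * \<bar>\<Sum>n. u n\<bar> \<le> (\<Sum>n. c n)"
proof -
  have wu: "\<bar>w * u n\<bar> \<le> c n" for n using assms(1) assms(2)[of n] by (simp add: abs_mult)
  have s: "summable (\<lambda>n. \<bar>w * u n\<bar>)"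
    by (rule summable_comparison_test'[OF assms(3), of 0]) (simp add: wu)
  then have "summable (\<lambda>n. (w * u n) / w)"
    by (rule summable_divide[OF summable_rabs_cancel])
  then show "summable u" using assms(1) by simp
  then have "w * \<bar>\<Sum>n. u n\<bar> = \<bar>\<Sum>n. w * u n\<bar>"
    using assms(1) by (simp add: suminf_mult abs_mult)
  also have "\<dots> \<le> (\<Sum>n. \<bar>w * u n\<bar>)" by (rule summable_rabs[OF s])
  also have "\<dots> \<le> (\<Sum>n. c n)"
    by (rule suminf_le[OF wu s assms(3)])
  finally show "w * \<bar>\<Sum>n. u n\<bar> \<le> (\<Sum>n. c n)" .
qed

lemma continuous_on_of_weighted:
  fixes f :: "real \<Rightarrow> real"
  assumes "continuous_on {0<..1} (\<lambda>x. x powr \<gamma> * f x)"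
  shows "continuous_on {0<..1} f"
proof -
  have "continuous_on {0<..1} (\<lambda>x. x powr - \<gamma> * (x powr \<gamma> * f x))"
    by (intro continuous_intros assms) auto
  then show ?thesis
    by (rule continuous_on_eq) (simp add: powr_minus)
qed

text \<open>Near \<open>0\<close> the bare terms need not have a summable uniform bound. The
  Weierstrass test is applied to the weighted terms, and the positive weight is divided out
  afterwards.\<close>

lemma continuous_on_weighted_suminf:
  fixes u :: "nat \<Rightarrow> real \<Rightarrow> real"
  assumes cont: "\<And>n. continuous_on {0<..1} (u n)"
    and bound: "\<And>n x. x \<in> {0<..1} \<Longrightarrow> x powr \<gamma> * \<bar>u n x\<bar> \<le> c n"
    and c: "summable c"
  shows "continuous_on {0<..1} (\<lambda>x. \<Sum>n. u n x)"
proof (rule continuous_on_of_weighted)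
  have "continuous_on {0<..1} (\<lambda>x. \<Sum>n. x powr \<gamma> * u n x)"
  proof (rule uniform_limit_theorem[where F = sequentially])
    show "uniform_limit {0<..1} (\<lambda>n x. \<Sum>i<n. x powr \<gamma> * u i x) (\<lambda>x. \<Sum>n. x powr \<gamma> * u n x) sequentially"
      by (rule Weierstrass_m_test[OF _ c]) (use bound in \<open>simp add: abs_mult\<close>)
    show "\<forall>\<^sub>F n in sequentially. continuous_on {0<..1} (\<lambda>x. \<Sum>i<n. x powr \<gamma> * u i x)"
      by (intro always_eventually allI continuous_intros cont) auto
  qed simp
  then show "continuous_on {0<..1} (\<lambda>x. x powr \<gamma> * (\<Sum>n. u n x))"
    by (rule continuous_on_eq) (use weighted_suminf_bound(1)[OF _ bound c] in \<open>simp add: suminf_mult\<close>)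
qed

section \<open>Difference quotients along moving arguments\<close>

lemma C0_norm_tendsto_0D:
  assumes "((\<lambda>t. C0_norm (f t)) \<longlongrightarrow> 0) F" "0 < e"
  shows "\<forall>\<^sub>F t in F. \<forall>y\<in>Dlt. \<bar>f t y\<bar> \<le> e"
  using assms by (simp add: tendsto_0_ennreal_iff C0_norm_le_iff)

lemma eventually_at_0_abs_le:
  fixes K e :: real
  assumes "0 < e"
  shows "\<forall>\<^sub>F t in at 0. K * \<bar>t\<bar> \<le> e"
proof -
  have "((\<lambda>t. K * \<bar>t\<bar>) \<longlongrightarrow> K * \<bar>0\<bar>) (at 0)" by (intro tendsto_intros)
  then have "\<forall>\<^sub>F t in at 0. K * \<bar>t\<bar> < e" using assms by (intro order_tendstoD(2)) auto
  then show ?thesis by (rule eventually_mono) simp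
qed

text \<open>In \<open>hh \<epsilon> (g \<epsilon> x)\<close> the function and its argument move
  together. With \<open>y\<close> the moved and \<open>z\<close> the original argument, three errors
  of size \<open>e / 3\<close> arise: the change of function at \<open>y\<close>, the shift of
  \<open>s\<close> from \<open>y\<close> to \<open>z\<close>, and the linearization of
  \<open>f 0\<close> at \<open>z\<close>.\<close>

lemma diff_quotient_expansion:
  fixes f :: "real \<Rightarrow> real \<Rightarrow> real"
  assumes C1: "C1_on_Dlt (f 0)" and s: "continuous_on Dlt s"
    and lim: "((\<lambda>t. C0_norm (\<lambda>y. (f t y - f 0 y) / t - s y)) \<longlongrightarrow> 0) (at 0)"
    and "0 < e" "0 \<le> K"
  shows "\<forall>\<^sub>F t in at 0. \<forall>y\<in>Dlt. \<forall>z\<in>Dlt. \<bar>y - z\<bar> \<le> K * \<bar>t\<bar> \<longrightarrow>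
    \<bar>(f t y - f 0 z) / t - s z - deriv_on Dlt (f 0) z * ((y - z) / t)\<bar> \<le> e"
proof -
  have "uniformly_continuous_on Dlt s"
    using s by (intro compact_uniformly_continuous) (auto simp: Dlt_def)
  then obtain d where d: "0 < d" "\<And>y z. y \<in> Dlt \<Longrightarrow> z \<in> Dlt \<Longrightarrow> \<bar>y - z\<bar> < d \<Longrightarrow> \<bar>s y - s z\<bar> < e/3"
    using \<open>0 < e\<close> unfolding uniformly_continuous_on_def dist_real_def
    by (metis zero_less_divide_iff zero_less_numeral)
  \<comment> \<open>The linearization error is at most \<open>k * \<bar>y - z\<bar>\<close>, and
    division by \<open>t\<close> turns \<open>\<bar>y - z\<bar>\<close> into at most
    \<open>K\<close>.\<close>
  define k where "k = e / (3 * (K + 1))"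
  have k: "0 < k" "k * K \<le> e / 3" using \<open>0 < e\<close> \<open>0 \<le> K\<close> by (auto simp: k_def field_simps)
  obtain d' where d': "0 < d'" "\<And>y z. y \<in> Dlt \<Longrightarrow> z \<in> Dlt \<Longrightarrow> \<bar>y - z\<bar> < d' \<Longrightarrow>
      \<bar>f 0 y - f 0 z - deriv_on Dlt (f 0) z * (y - z)\<bar> \<le> k * \<bar>y - z\<bar>"
    by (rule C1_on_Dlt_uniformly_differentiable[OF C1 k(1)]) blast
  have "0 < e / 3" "0 < min d d' / 2" using \<open>0 < e\<close> d(1) d'(1) by auto
  note C0_norm_tendsto_0D[OF lim this(1)] eventually_at_0_abs_le[OF this(2), of K]
    eventually_neq_at_within[of 0 0 UNIV]
  then show ?thesis
  proof eventually_elim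
    case (elim t)
    show ?case
    proof (intro ballI impI)
      fix y z assume yz: "y \<in> Dlt" "z \<in> Dlt" "\<bar>y - z\<bar> \<le> K * \<bar>t\<bar>"
      have "0 < \<bar>t\<bar>" using elim(3) by simp
      have close: "\<bar>y - z\<bar> < d" "\<bar>y - z\<bar> < d'" using yz(3) elim(2) d(1) d'(1) by auto
      have "\<bar>(f 0 y - f 0 z - deriv_on Dlt (f 0) z * (y - z)) / t\<bar> \<le> k * \<bar>y - z\<bar> / \<bar>t\<bar>"
        using d'(2)[OF yz(1,2) close(2)] by (simp add: divide_right_mono)
      also have "\<dots> \<le> k * (K * \<bar>t\<bar>) / \<bar>t\<bar>"
        using yz(3) k(1) by (intro divide_right_mono mult_left_mono) auto
      also have "\<dots> \<le> e / 3" using k(2) \<open>0 < \<bar>t\<bar>\<close> by simp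
      finally have "\<bar>(f 0 y - f 0 z - deriv_on Dlt (f 0) z * (y - z)) / t\<bar> \<le> e / 3" .
      moreover have "\<bar>(f t y - f 0 y) / t - s y\<bar> \<le> e / 3" using elim(1) yz(1) by blast
      moreover have "\<bar>s y - s z\<bar> \<le> e / 3" using d(2)[OF yz(1,2) close(1)] by simp
      moreover have "(f t y - f 0 z) / t - s z - deriv_on Dlt (f 0) z * ((y - z) / t)
          = ((f t y - f 0 y) / t - s y) + (s y - s z)
            + (f 0 y - f 0 z - deriv_on Dlt (f 0) z * (y - z)) / t"
        using \<open>0 < \<bar>t\<bar>\<close> by (simp add: field_simps)
      ultimately show "\<bar>(f t y - f 0 z) / t - s z - deriv_on Dlt (f 0) z * ((y - z) / t)\<bar> \<le> e"
        by linarith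
    qed
  qed
qed

text \<open>One constant bounds both the difference quotient and its formal limit. It depends on the
  displacement only through \<open>K\<close>, hence is the same for all words.\<close>

lemma diff_quotient_bounded:
  fixes f :: "real \<Rightarrow> real \<Rightarrow> real"
  assumes C1: "C1_on_Dlt (f 0)" and s: "continuous_on Dlt s"
    and lim: "((\<lambda>t. C0_norm (\<lambda>y. (f t y - f 0 y) / t - s y)) \<longlongrightarrow> 0) (at 0)"
    and "0 \<le> K"
  obtains B where "0 < B"
    "\<forall>\<^sub>F t in at 0. \<forall>y\<in>Dlt. \<forall>z\<in>Dlt. \<bar>y - z\<bar> \<le> K * \<bar>t\<bar> \<longrightarrow> \<bar>f t y - f 0 z\<bar> \<le> B * \<bar>t\<bar>"
    "\<And>z w. z \<in> Dlt \<Longrightarrow> \<bar>w\<bar> \<le> K \<Longrightarrow> \<bar>s z + deriv_on Dlt (f 0) z * w\<bar> \<le> B"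
proof -
  obtain M where M: "0 < M" "\<And>y. y \<in> Dlt \<Longrightarrow> \<bar>s y\<bar> \<le> M"
    by (rule continuous_on_Dlt_bounded[OF s]) blast
  obtain L where L: "0 < L" "\<And>y. y \<in> Dlt \<Longrightarrow> \<bar>deriv_on Dlt (f 0) y\<bar> \<le> L"
    by (rule continuous_on_Dlt_bounded[OF C1_on_Dlt_continuous_deriv[OF C1]]) blast
  have lin: "\<bar>s z + deriv_on Dlt (f 0) z * w\<bar> \<le> M + L * K" if "z \<in> Dlt" "\<bar>w\<bar> \<le> K" for z w
  proof -
    have "\<bar>deriv_on Dlt (f 0) z * w\<bar> \<le> L * K"
      unfolding abs_mult using that L \<open>0 \<le> K\<close> by (intro mult_mono) auto
    then show ?thesis using M(2)[OF that(1)] by linarith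
  qed
  show ?thesis
  \<comment> \<open>\<open>M\<close> and \<open>L * K\<close> bound the two parts of the formal
    limit; the \<open>1\<close> is the error allowed by the expansion with
    \<open>e = 1\<close>.\<close>
  proof (rule that[of "1 + M + L * K"])
    show "0 < 1 + M + L * K" using M L \<open>0 \<le> K\<close> by (simp add: add_pos_nonneg)
    show "\<bar>s z + deriv_on Dlt (f 0) z * w\<bar> \<le> 1 + M + L * K" if "z \<in> Dlt" "\<bar>w\<bar> \<le> K" for z w
      using lin[OF that] by simp
    show "\<forall>\<^sub>F t in at 0. \<forall>y\<in>Dlt. \<forall>z\<in>Dlt. \<bar>y - z\<bar> \<le> K * \<bar>t\<bar> \<longrightarrow> \<bar>f t y - f 0 z\<bar> \<le> (1 + M + L * K) * \<bar>t\<bar>"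
      using diff_quotient_expansion[OF C1 s lim zero_less_one \<open>0 \<le> K\<close>] eventually_neq_at_within[of 0 0 UNIV]
    proof eventually_elim
      case (elim t)
      show ?case
      proof (intro ballI impI)
        fix y z assume yz: "y \<in> Dlt" "z \<in> Dlt" "\<bar>y - z\<bar> \<le> K * \<bar>t\<bar>"
        have t: "0 < \<bar>t\<bar>" using elim(2) by simp
        have "\<bar>(y - z) / t\<bar> \<le> K" using yz(3) t by (simp add: field_simps)
        with lin[OF yz(2) this] elim(1) yz
        have "\<bar>(f t y - f 0 z) / t\<bar> \<le> 1 + M + L * K" by fastforce
        then show "\<bar>f t y - f 0 z\<bar> \<le> (1 + M + L * K) * \<bar>t\<bar>"
          using t by (simp add: field_simps)
      qed
    qed
  qed
qed

section \<open>Composed branches: uniform bounds, and the densities as elements of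
  \<open>B_space \<gamma>\<close>\<close>

context map_family
begin

lemma inv_branch_0_funpow_mem:
  assumes "\<epsilon> \<in> V" "x \<in> {0..1}"
  shows "(inv_branch Tb 0 \<epsilon> ^^ n) x \<in> {0..1}"
proof (induction n)
  case (Suc n)
  then show ?case
    using inv_branch_mem[OF assms(1), of 0 "(inv_branch Tb 0 \<epsilon> ^^ n) x"]
    by (auto simp: branch_dom_def)
qed (use assms in auto)

lemma g_word_mem_Dlt:
  assumes "\<epsilon> \<in> V" "x \<in> {0..1}"
  shows "g_word Tb n \<epsilon> x \<in> Dlt"
  using inv_branch_mem[OF assms(1) _ inv_branch_0_funpow_mem[OF assms], of 1]
  by (simp add: g_word_def branch_dom_def Dlt_def)

lemma g_word_has_derivative:
  assumes \<epsilon>: "\<epsilon> \<in> V" and x: "x \<in> {0..1}"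
  shows "(g_word Tb n \<epsilon> has_real_derivative Dx (g_word Tb n \<epsilon>) x) (at x within {0..1})"
proof -
  let ?I = "{0..1::real}"
  have comp: "(inv_branch Tb i \<epsilon> \<circ> f) differentiable (at x within ?I)"
    if "i \<in> {0,1}" "f differentiable (at x within ?I)" "f ` ?I \<subseteq> ?I" for i f
  proof (rule differentiable_chain_within[OF that(2)])
    have "f x \<in> ?I" using that(3) x by blast
    then have "inv_branch Tb i \<epsilon> differentiable (at (f x) within ?I)"
      using that(1) by (intro g_diff[OF \<epsilon>])
    then show "inv_branch Tb i \<epsilon> differentiable (at (f x) within f ` ?I)"
      by (rule differentiable_within_subset) (rule that(3))
  qed
  have maps: "(inv_branch Tb 0 \<epsilon> ^^ m) ` ?I \<subseteq> ?I" for m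
    using inv_branch_0_funpow_mem[OF \<epsilon>] by blast
  have "(inv_branch Tb 0 \<epsilon> ^^ m) differentiable (at x within ?I)" for m
  proof (induction m)
    case (Suc m)
    then show ?case using comp[of 0 "inv_branch Tb 0 \<epsilon> ^^ m"] maps by (simp add: comp_def)
  qed (simp add: id_def)
  then have "g_word Tb n \<epsilon> differentiable (at x within ?I)"
    unfolding g_word_def using maps by (intro comp) auto
  then show ?thesis
    unfolding deriv_on_def has_real_derivative_iff_has_vector_derivative
    by (simp add: vector_derivative_works)
qed

lemma continuous_on_g_word:
  assumes "\<epsilon> \<in> V"
  shows "continuous_on {0..1} (g_word Tb n \<epsilon>)"
  using g_word_has_derivative[OF assms] by (rule DERIV_continuous_on)

text \<open>The suprema over \<epsilon> are summable for each of the two families; adding them gives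
  a single majorant for both, independent of \<epsilon> and \<open>x\<close>.\<close>

lemma word_majorant:
  obtains c where "summable c" "\<And>n. 0 \<le> c n"
    "\<And>n \<epsilon> x. \<epsilon> \<in> V \<Longrightarrow> x \<in> {0<..1} \<Longrightarrow> x powr \<gamma> * \<bar>Dx (g_word Tb n \<epsilon>) x\<bar> \<le> c n"
    "\<And>n \<epsilon> x. \<epsilon> \<in> V \<Longrightarrow> x \<in> {0<..1} \<Longrightarrow> x powr \<gamma> * \<bar>Deps (\<lambda>e. Dx (g_word Tb n e)) \<epsilon> x\<bar> \<le> c n"
proof -
  obtain p where p: "summable p" "\<And>n. 0 \<le> p n"
      "\<And>n. (SUP \<epsilon>\<in>V. B_norm \<gamma> (Dx (g_word Tb n \<epsilon>))) = ennreal (p n)"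
    using ennreal_summable_majorant[OF gw'_sum] by blast
  obtain q where q: "summable q" "\<And>n. 0 \<le> q n"
      "\<And>n. (SUP \<epsilon>\<in>V. B_norm \<gamma> (Deps (\<lambda>e. Dx (g_word Tb n e)) \<epsilon>)) = ennreal (q n)"
    using ennreal_summable_majorant[OF eps_gw'_sum] by blast
  show ?thesis
  proof (rule that[of "\<lambda>n. p n + q n"])
    fix n \<epsilon> x assume \<epsilon>: "\<epsilon> \<in> V" and x: "x \<in> {0<..1::real}"
    have "B_norm \<gamma> (Dx (g_word Tb n \<epsilon>)) \<le> ennreal (p n)"
      unfolding p(3)[symmetric] using \<epsilon> by (rule SUP_upper)
    then show "x powr \<gamma> * \<bar>Dx (g_word Tb n \<epsilon>) x\<bar> \<le> p n + q n"
      using x p(2) q(2)[of n] by (force simp: B_norm_le_iff)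
    have "B_norm \<gamma> (Deps (\<lambda>e. Dx (g_word Tb n e)) \<epsilon>) \<le> ennreal (q n)"
      unfolding q(3)[symmetric] using \<epsilon> by (rule SUP_upper)
    then show "x powr \<gamma> * \<bar>Deps (\<lambda>e. Dx (g_word Tb n e)) \<epsilon> x\<bar> \<le> p n + q n"
      using x q(2) p(2)[of n] by (force simp: B_norm_le_iff)
  qed (use p q in \<open>auto intro: summable_add\<close>)
qed

lemma Dx_g_word_bounded:
  obtains C where "0 \<le> C" "\<And>\<epsilon> x. \<epsilon> \<in> V \<Longrightarrow> x \<in> {0..1} \<Longrightarrow> \<bar>Dx (g_word Tb n \<epsilon>) x\<bar> \<le> C"
proof -
  define S where "S = (SUP \<epsilon>\<in>V. SUP x\<in>{0..1}. ennreal \<bar>Dx (g_word Tb n \<epsilon>) x\<bar>)"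
  have S: "S = ennreal (enn2real S)" using gw'_bdd[of n] by (simp add: S_def)
  show ?thesis
  proof (rule that[of "enn2real S"])
    fix \<epsilon> x assume "\<epsilon> \<in> V" "x \<in> {0..1::real}"
    then have "ennreal \<bar>Dx (g_word Tb n \<epsilon>) x\<bar> \<le> S"
      unfolding S_def by (blast intro: SUP_upper2)
    then show "\<bar>Dx (g_word Tb n \<epsilon>) x\<bar> \<le> enn2real S" by (subst (asm) S) simp
  qed simp
qed

text \<open>\<open>K\<close> is chosen before \<open>n\<close>, unlike the bound on the space
  derivatives; this makes the Lipschitz constant in \<epsilon> common to all words.\<close>

lemma Deps_g_word_bounded:
  obtains K where "0 \<le> K" "\<And>n \<epsilon> x. \<epsilon> \<in> V \<Longrightarrow> x \<in> {0..1} \<Longrightarrow> \<bar>Deps (g_word Tb n) \<epsilon> x\<bar> \<le> K"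
proof -
  define S where "S = (SUP n. SUP \<epsilon>\<in>V. SUP x\<in>{0..1}. ennreal \<bar>Deps (g_word Tb n) \<epsilon> x\<bar>)"
  have S: "S = ennreal (enn2real S)" using eps_gw_bdd by (simp add: S_def)
  show ?thesis
  proof (rule that[of "enn2real S"])
    fix n \<epsilon> x assume "\<epsilon> \<in> V" "x \<in> {0..1::real}"
    then have "ennreal \<bar>Deps (g_word Tb n) \<epsilon> x\<bar> \<le> S"
      unfolding S_def by (blast intro: SUP_upper2)
    then show "\<bar>Deps (g_word Tb n) \<epsilon> x\<bar> \<le> enn2real S" by (subst (asm) S) simp
  qed simp
qed

lemma radius_exists:
  obtains r where "0 < r" "\<And>e. \<bar>e\<bar> < r \<Longrightarrow> e \<in> V"
proof -
  obtain r where "0 < r" "ball 0 r \<subseteq> V" using nbhd openE by blast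
  then show ?thesis by (intro that[of r]) (auto simp: subset_iff)
qed

text \<open>The series of \<open>F_op\<close> without the cutoff by \<open>Dlt\<close>. It makes
  sense on all of \<open>{0<..1}\<close>, so its value at \<open>1/2\<close>, where
  \<open>F_op\<close> has already switched formulas, can be compared with
  \<open>\<Phi> (1/2)\<close>.\<close>

definition transfer :: "real \<Rightarrow> (real \<Rightarrow> real) \<Rightarrow> real \<Rightarrow> real" where
  "transfer \<epsilon> \<Phi> x = (\<Sum>n. \<Phi> (g_word Tb n \<epsilon> x) * Dx (g_word Tb n \<epsilon>) x)"

text \<open>The weight is charged to \<open>v\<close> alone, as \<open>\<Phi>\<close> is bounded on
  \<open>Dlt\<close>. Leaving \<open>v\<close> free lets one bound serve for \<open>g'\<close>, its
  parameter derivative and its difference quotients.\<close>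

lemma transfer_term_bound:
  assumes "\<epsilon> \<in> V" "x \<in> {0<..1}" "0 \<le> M" "\<And>y. y \<in> Dlt \<Longrightarrow> \<bar>\<Phi> y\<bar> \<le> M"
    and "x powr \<gamma> * \<bar>v\<bar> \<le> c"
  shows "x powr \<gamma> * \<bar>\<Phi> (g_word Tb n \<epsilon> x) * v\<bar> \<le> M * c"
proof -
  have "\<bar>\<Phi> (g_word Tb n \<epsilon> x)\<bar> \<le> M"
    using assms(1,2) by (intro assms(4) g_word_mem_Dlt) auto
  then have "\<bar>\<Phi> (g_word Tb n \<epsilon> x)\<bar> * (x powr \<gamma> * \<bar>v\<bar>) \<le> M * c"
    using assms by (intro mult_mono) auto
  then show ?thesis by (simp add: abs_mult algebra_simps)
qed

lemma continuous_on_transfer: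
  assumes \<epsilon>: "\<epsilon> \<in> V" and \<Phi>: "continuous_on Dlt \<Phi>"
  shows "continuous_on {0<..1} (transfer \<epsilon> \<Phi>)"
proof -
  obtain c where c: "summable c" "\<And>n. 0 \<le> c n"
    "\<And>n \<epsilon> x. \<epsilon> \<in> V \<Longrightarrow> x \<in> {0<..1} \<Longrightarrow> x powr \<gamma> * \<bar>Dx (g_word Tb n \<epsilon>) x\<bar> \<le> c n"
    "\<And>n \<epsilon> x. \<epsilon> \<in> V \<Longrightarrow> x \<in> {0<..1} \<Longrightarrow> x powr \<gamma> * \<bar>Deps (\<lambda>e. Dx (g_word Tb n e)) \<epsilon> x\<bar> \<le> c n"
    by (rule word_majorant) blast
  obtain M where M: "0 < M" "\<And>y. y \<in> Dlt \<Longrightarrow> \<bar>\<Phi> y\<bar> \<le> M"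
    by (rule continuous_on_Dlt_bounded[OF \<Phi>]) blast
  show ?thesis
    unfolding transfer_def
  proof (rule continuous_on_weighted_suminf)
    fix n
    have "continuous_on {0<..1} (g_word Tb n \<epsilon>)"
      using continuous_on_g_word[OF \<epsilon>] by (rule continuous_on_subset) auto
    moreover have "g_word Tb n \<epsilon> ` {0<..1} \<subseteq> Dlt"
      using g_word_mem_Dlt[OF \<epsilon>] by auto
    ultimately have "continuous_on {0<..1} (\<lambda>x. \<Phi> (g_word Tb n \<epsilon> x))"
      by (rule continuous_on_compose2[OF \<Phi>])
    moreover have "continuous_on {0<..1} (Dx (g_word Tb n \<epsilon>))"
      using gw'_B[OF \<epsilon>] by (simp add: B_space_def)
    ultimately show "continuous_on {0<..1} (\<lambda>x. \<Phi> (g_word Tb n \<epsilon> x) * Dx (g_word Tb n \<epsilon>) x)"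
      by (rule continuous_on_mult)
    show "x powr \<gamma> * \<bar>\<Phi> (g_word Tb n \<epsilon> x) * Dx (g_word Tb n \<epsilon>) x\<bar> \<le> M * c n"
      if "x \<in> {0<..1}" for x
      using \<epsilon> that M c by (intro transfer_term_bound) auto
  qed (rule summable_mult[OF c(1)])
qed

lemma F_op_eq: "F_op Tb \<epsilon> \<Phi> x = (if x \<in> Dlt then \<Phi> x else transfer \<epsilon> \<Phi> x)"
  by (simp add: F_op_def transfer_def)

lemma h_in_B_space:
  assumes \<epsilon>: "\<epsilon> \<in> V"
  shows "h \<epsilon> \<in> B_space \<gamma>"
proof -
  let ?P = "transfer \<epsilon> (hh \<epsilon>)"
  have hP: "h \<epsilon> x = ?P x" if "x \<in> {0<..<1/2}" for x
    using h_eq[OF \<epsilon>, of x] that by (simp add: F_op_eq Dlt_def)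
  have P: "continuous_on {0<..1} ?P" by (rule continuous_on_transfer[OF \<epsilon> hh_cont[OF \<epsilon>]])
  \<comment> \<open>The series is continuous up to \<open>1/2\<close> but is known to equal
    \<open>h \<epsilon>\<close> only to the left of it; invariance supplies the missing
    equality.\<close>
  have half: "?P (1/2) = hh \<epsilon> (1/2)"
    using P hP by (intro density_continuous_at_half[OF \<epsilon>]) (auto intro: continuous_on_subset)
  have "continuous_on ({0<..1/2} \<union> {1/2..1}) (\<lambda>x. if x \<le> 1/2 then ?P x else hh \<epsilon> x)"
  proof (rule continuous_on_cases_local[of "{0<..1/2}" "{1/2..1}" "?P" "hh \<epsilon>"])
    show "closedin (top_of_set ({0<..1/2} \<union> {1/2..1})) {0<..1/2::real}"
      unfolding closedin_closed by (rule exI[of _ "{..1/2}"]) auto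
    show "closedin (top_of_set ({0<..1/2} \<union> {1/2..1})) {1/2..1::real}"
      by (rule closed_subset) auto
    show "continuous_on {0<..1/2} ?P" using P by (rule continuous_on_subset) auto
    show "continuous_on {1/2..1} (hh \<epsilon>)" using hh_cont[OF \<epsilon>] by (simp add: Dlt_def)
    show "?P x = hh \<epsilon> x" if "x \<in> {0<..1/2} \<and> \<not> x \<le> 1/2 \<or> x \<in> {1/2..1} \<and> x \<le> 1/2" for x
    proof -
      have "x = 1/2" using that by auto
      then show ?thesis using half by (simp only:)
    qed
  qed
  then have "continuous_on {0<..1} (\<lambda>x. if x \<le> 1/2 then ?P x else hh \<epsilon> x)"
    by (rule continuous_on_subset) auto
  then have cont: "continuous_on {0<..1} (h \<epsilon>)"
  proof (rule continuous_on_eq)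
    fix x :: real assume x: "x \<in> {0<..1}"
    show "(if x \<le> 1/2 then ?P x else hh \<epsilon> x) = h \<epsilon> x"
    proof (cases "x < 1/2")
      case True
      then show ?thesis using x hP by simp
    next
      case False
      then have "h \<epsilon> x = hh \<epsilon> x" using x by (intro h_eq_hh[OF \<epsilon>]) (simp add: Dlt_def)
      moreover have "?P x = hh \<epsilon> x" if "x \<le> 1/2"
      proof -
        have "x = 1/2" using that False by simp
        then show ?thesis using half by (simp only:)
      qed
      ultimately show ?thesis by simp
    qed
  qed
  obtain c where c: "summable c" "\<And>n. 0 \<le> c n"
    "\<And>n \<epsilon> x. \<epsilon> \<in> V \<Longrightarrow> x \<in> {0<..1} \<Longrightarrow> x powr \<gamma> * \<bar>Dx (g_word Tb n \<epsilon>) x\<bar> \<le> c n"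
    "\<And>n \<epsilon> x. \<epsilon> \<in> V \<Longrightarrow> x \<in> {0<..1} \<Longrightarrow> x powr \<gamma> * \<bar>Deps (\<lambda>e. Dx (g_word Tb n e)) \<epsilon> x\<bar> \<le> c n"
    by (rule word_majorant) blast
  obtain M where M: "0 < M" "\<And>y. y \<in> Dlt \<Longrightarrow> \<bar>hh \<epsilon> y\<bar> \<le> M"
    by (rule continuous_on_Dlt_bounded[OF hh_cont[OF \<epsilon>]]) blast
  have sum0: "0 \<le> (\<Sum>n. M * c n)" using c M by (intro suminf_nonneg summable_mult) auto
  have "B_norm \<gamma> (h \<epsilon>) \<le> ennreal (M + (\<Sum>n. M * c n))"
  proof (subst B_norm_le_iff)
    show "0 \<le> M + (\<Sum>n. M * c n)" using M sum0 by simp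
    show "\<forall>x\<in>{0<..1}. x powr \<gamma> * \<bar>h \<epsilon> x\<bar> \<le> M + (\<Sum>n. M * c n)"
    proof
      fix x :: real assume x: "x \<in> {0<..1}"
      show "x powr \<gamma> * \<bar>h \<epsilon> x\<bar> \<le> M + (\<Sum>n. M * c n)"
      proof (cases "x < 1/2")
        case True
        have "x powr \<gamma> * \<bar>?P x\<bar> \<le> (\<Sum>n. M * c n)"
          unfolding transfer_def using x M c(1) c(3)[OF \<epsilon> x]
          by (intro weighted_suminf_bound(2) transfer_term_bound[OF \<epsilon>] summable_mult) auto
        then show ?thesis using hP[of x] True x M by simp
      next
        case False
        then have "\<bar>h \<epsilon> x\<bar> \<le> M"
          using x M(2)[of x] h_eq_hh[OF \<epsilon>, of x] by (simp add: Dlt_def)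
        moreover have "x powr \<gamma> \<le> 1" using x gamma_pos by (intro powr_le1) auto
        ultimately have "x powr \<gamma> * \<bar>h \<epsilon> x\<bar> \<le> 1 * M" by (intro mult_mono) auto
        then show ?thesis using sum0 by simp
      qed
    qed
  qed
  then have "B_norm \<gamma> (h \<epsilon>) < \<infinity>" by (rule le_less_trans) simp
  with cont show ?thesis by (simp add: B_space_def)
qed

end

subsection \<open>Linear response\<close>

context map_family
begin

lemma g_word_lipschitz:
  assumes r: "\<And>e. \<bar>e\<bar> < r \<Longrightarrow> e \<in> V"
    and K: "\<And>n \<epsilon> x. \<epsilon> \<in> V \<Longrightarrow> x \<in> {0..1} \<Longrightarrow> \<bar>Deps (g_word Tb n) \<epsilon> x\<bar> \<le> K"
    and "\<bar>\<epsilon>\<bar> < r" "x \<in> {0..1}"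
  shows "\<bar>g_word Tb n \<epsilon> x - g_word Tb n 0 x\<bar> \<le> K * \<bar>\<epsilon>\<bar>"
  using assms by (intro Deps_lipschitz[where r = r] gw_eps_diff) auto

text \<open>The space derivative of the quotient is the quotient for \<open>g'\<close>, which
  converges in the weighted norm, and the Lipschitz bound in \<epsilon> keeps the quotient itself
  below \<open>K\<close>. Differentiability in \<epsilon> alone gives only pointwise convergence to
  \<open>a_word\<close>.\<close>

lemma a_word_uniform_limit:
  assumes r: "0 < r" "\<And>e. \<bar>e\<bar> < r \<Longrightarrow> e \<in> V"
    and K: "\<And>n \<epsilon> x. \<epsilon> \<in> V \<Longrightarrow> x \<in> {0..1} \<Longrightarrow> \<bar>Deps (g_word Tb n) \<epsilon> x\<bar> \<le> K"
  shows "uniform_limit {0<..1}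
    (\<lambda>\<epsilon> x. x powr \<gamma> * ((g_word Tb n \<epsilon> x - g_word Tb n 0 x) / \<epsilon> - a_word Tb n x)) (\<lambda>x. 0) (at 0)"
proof (rule uniform_limit_weighted_from_derivative[OF gamma_pos,
      where D' = "\<lambda>\<epsilon> x. (Dx (g_word Tb n \<epsilon>) x - Dx (g_word Tb n 0) x) / \<epsilon>" and b = "b_word Tb n"])
  have near: "\<forall>\<^sub>F \<epsilon> in at 0. \<bar>\<epsilon>\<bar> < r \<and> \<epsilon> \<noteq> 0"
    using r(1) by (auto simp: eventually_at dist_real_def)
  have V0: "0 \<in> V" by (rule nbhd(2))
  show "\<forall>\<^sub>F \<epsilon> in at 0. \<forall>x\<in>{0<..1}.
      ((\<lambda>x. (g_word Tb n \<epsilon> x - g_word Tb n 0 x) / \<epsilon>) has_real_derivative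
        (Dx (g_word Tb n \<epsilon>) x - Dx (g_word Tb n 0) x) / \<epsilon>) (at x within {0<..1})"
    using near
  proof eventually_elim
    case (elim \<epsilon>)
    have "(g_word Tb n e has_real_derivative Dx (g_word Tb n e) x) (at x within {0<..1})"
      if "e \<in> V" "x \<in> {0<..1}" for e x
      using that by (intro has_field_derivative_subset[OF g_word_has_derivative[OF that(1)]]) auto
    then show ?case using V0 r(2) elim by (auto intro!: DERIV_cdivide DERIV_diff)
  qed
  show "uniform_limit {0<..1} (\<lambda>\<epsilon> x. x powr \<gamma> *
      ((Dx (g_word Tb n \<epsilon>) x - Dx (g_word Tb n 0) x) / \<epsilon> - b_word Tb n x)) (\<lambda>x. 0) (at 0)"
    using gw'_diff_B[of n] by (simp add: B_norm_tendsto_0_iff)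
  show "((\<lambda>\<epsilon>. (g_word Tb n \<epsilon> x - g_word Tb n 0 x) / \<epsilon>) \<longlongrightarrow> a_word Tb n x) (at 0)"
    if "x \<in> {0<..1}" for x
    unfolding a_word_def using that V0 by (intro Deps_tendsto gw_eps_diff) auto
  show "\<forall>\<^sub>F \<epsilon> in at 0. \<forall>x\<in>{0<..1}. \<bar>(g_word Tb n \<epsilon> x - g_word Tb n 0 x) / \<epsilon>\<bar> \<le> K"
    using near
  proof eventually_elim
    case (elim \<epsilon>)
    show ?case
    proof
      fix x :: real assume "x \<in> {0<..1}"
      then have "\<bar>g_word Tb n \<epsilon> x - g_word Tb n 0 x\<bar> \<le> K * \<bar>\<epsilon>\<bar>"
        using elim by (intro g_word_lipschitz[OF r(2) K]) auto
      then show "\<bar>(g_word Tb n \<epsilon> x - g_word Tb n 0 x) / \<epsilon>\<bar> \<le> K"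
        using elim by (simp add: pos_divide_le_eq)
    qed
  qed
qed simp

end

text \<open>The error is a sum of four products, each with one small factor. \<open>D\<close> is the
  true quotient of the branch: \<open>u\<close> is first compared with its linearization along
  \<open>D\<close>, and only then is \<open>D\<close> replaced by \<open>a\<close>. The weight goes
  in turn to \<open>v0\<close>, to \<open>D - a\<close>, to the error of \<open>v\<close>, and to
  \<open>b\<close>. In the second product \<open>v0\<close> is left unweighted, whence
  \<open>C\<close>; the first and the fourth contribute \<open>2 * c\<close>.\<close>

lemma diff_quotient_product_bound:
  fixes t u u0 v v0 D a b s l w :: real
  assumes "t \<noteq> 0" "0 \<le> w" "0 \<le> \<eta>"
    and 1: "\<bar>(u - u0) / t - s - l * D\<bar> \<le> \<eta>" and 2: "w * \<bar>D - a\<bar> \<le> \<eta>"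
    and 3: "w * \<bar>(v - v0) / t - b\<bar> \<le> \<eta>" and 4: "\<bar>u - u0\<bar> \<le> \<eta>"
    and 5: "\<bar>l\<bar> \<le> L" and 6: "\<bar>v0\<bar> \<le> C" and 7: "\<bar>u\<bar> \<le> M"
    and 8: "w * \<bar>v0\<bar> \<le> c" and 9: "w * \<bar>b\<bar> \<le> c"
  shows "w * \<bar>(u * v - u0 * v0) / t - (s * v0 + (l * a * v0 + u0 * b))\<bar> \<le> \<eta> * (2 * c + L * C + M)"
proof -
  have "(u * v - u0 * v0) / t - (s * v0 + (l * a * v0 + u0 * b))
      = ((u - u0) / t - s - l * D) * v0 + l * (D - a) * v0 + u * ((v - v0) / t - b) + (u - u0) * b"
    using \<open>t \<noteq> 0\<close> by (simp add: field_simps)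
  also have "\<bar>\<dots>\<bar> \<le> \<bar>(u - u0) / t - s - l * D\<bar> * \<bar>v0\<bar> + \<bar>l\<bar> * \<bar>D - a\<bar> * \<bar>v0\<bar>
      + \<bar>u\<bar> * \<bar>(v - v0) / t - b\<bar> + \<bar>u - u0\<bar> * \<bar>b\<bar>"
    unfolding abs_mult[symmetric] by linarith
  finally have "w * \<bar>(u * v - u0 * v0) / t - (s * v0 + (l * a * v0 + u0 * b))\<bar>
      \<le> w * (\<bar>(u - u0) / t - s - l * D\<bar> * \<bar>v0\<bar> + \<bar>l\<bar> * \<bar>D - a\<bar> * \<bar>v0\<bar>
      + \<bar>u\<bar> * \<bar>(v - v0) / t - b\<bar> + \<bar>u - u0\<bar> * \<bar>b\<bar>)"
    using \<open>0 \<le> w\<close> by (rule mult_left_mono)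
  also have "\<dots> = \<bar>(u - u0) / t - s - l * D\<bar> * (w * \<bar>v0\<bar>) + (w * \<bar>D - a\<bar>) * (\<bar>l\<bar> * \<bar>v0\<bar>)
      + (w * \<bar>(v - v0) / t - b\<bar>) * \<bar>u\<bar> + \<bar>u - u0\<bar> * (w * \<bar>b\<bar>)"
    by (simp add: algebra_simps)
  also have "\<dots> \<le> \<eta> * c + \<eta> * (L * C) + \<eta> * M + \<eta> * c"
  proof (intro add_mono)
    show "\<bar>(u - u0) / t - s - l * D\<bar> * (w * \<bar>v0\<bar>) \<le> \<eta> * c"
      using 1 8 \<open>0 \<le> \<eta>\<close> \<open>0 \<le> w\<close> by (intro mult_mono) auto
    have "\<bar>l\<bar> * \<bar>v0\<bar> \<le> L * C" using 5 6 by (intro mult_mono) auto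
    then show "(w * \<bar>D - a\<bar>) * (\<bar>l\<bar> * \<bar>v0\<bar>) \<le> \<eta> * (L * C)"
      using \<open>0 \<le> \<eta>\<close> by (intro mult_mono[OF 2]) auto
    show "(w * \<bar>(v - v0) / t - b\<bar>) * \<bar>u\<bar> \<le> \<eta> * M"
      using 3 7 \<open>0 \<le> \<eta>\<close> by (intro mult_mono) auto
    show "\<bar>u - u0\<bar> * (w * \<bar>b\<bar>) \<le> \<eta> * c"
      using 4 9 \<open>0 \<le> \<eta>\<close> \<open>0 \<le> w\<close> by (intro mult_mono) auto
  qed
  finally show ?thesis by (simp add: algebra_simps)
qed

section \<open>Errors of the individual words and their sum\<close>

context map_family
begin

context
  fixes s :: "real \<Rightarrow> real"
  assumes C1: "C1_on_Dlt (hh 0)" and s: "continuous_on Dlt s"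
    and lim: "((\<lambda>\<epsilon>. C0_norm (\<lambda>x. (hh \<epsilon> x - hh 0 x) / \<epsilon> - s x)) \<longlongrightarrow> 0) (at 0)"
begin

text \<open>The subtracted terms are the summands for the word \<open>n\<close> in
  \<open>F_op Tb 0 s\<close> and \<open>Q_op Tb (hh 0)\<close>. With this grouping the errors add up
  to that of the full difference quotient off \<open>Dlt\<close>.\<close>

definition remainder :: "nat \<Rightarrow> real \<Rightarrow> real \<Rightarrow> real" where
  "remainder n \<epsilon> x =
    (hh \<epsilon> (g_word Tb n \<epsilon> x) * Dx (g_word Tb n \<epsilon>) x - hh 0 (g_word Tb n 0 x) * Dx (g_word Tb n 0) x) / \<epsilon>
    - (s (g_word Tb n 0 x) * Dx (g_word Tb n 0) x
      + (deriv_on Dlt (hh 0) (g_word Tb n 0 x) * a_word Tb n x * Dx (g_word Tb n 0) x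
        + hh 0 (g_word Tb n 0 x) * b_word Tb n x))"

lemma hh_bounded_near_0:
  obtains M where "0 < M" "\<forall>\<^sub>F \<epsilon> in at 0. \<forall>y\<in>Dlt. \<bar>hh \<epsilon> y\<bar> \<le> M" "\<And>y. y \<in> Dlt \<Longrightarrow> \<bar>hh 0 y\<bar> \<le> M"
proof -
  obtain M where M: "0 < M" "\<And>y. y \<in> Dlt \<Longrightarrow> \<bar>hh 0 y\<bar> \<le> M"
    by (rule continuous_on_Dlt_bounded[OF hh_cont[OF nbhd(2)]]) blast
  \<comment> \<open>Displacement bound \<open>0\<close> forces \<open>y = z\<close>: the argument is
    fixed and only the function varies.\<close>
  obtain B where B: "0 < B"
    "\<forall>\<^sub>F t in at 0. \<forall>y\<in>Dlt. \<forall>z\<in>Dlt. \<bar>y - z\<bar> \<le> 0 * \<bar>t\<bar> \<longrightarrow> \<bar>hh t y - hh 0 z\<bar> \<le> B * \<bar>t\<bar>"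
    by (rule diff_quotient_bounded[OF C1 s lim order_refl]) blast
  have "\<forall>\<^sub>F \<epsilon> in at 0. \<forall>y\<in>Dlt. \<bar>hh \<epsilon> y\<bar> \<le> M + 1"
    using B(2) eventually_at_0_abs_le[OF zero_less_one, of B]
  proof eventually_elim
    case (elim \<epsilon>)
    show ?case
    proof
      fix y assume y: "y \<in> Dlt"
      have "\<bar>hh \<epsilon> y - hh 0 y\<bar> \<le> B * \<bar>\<epsilon>\<bar>" using elim(1) y by simp
      with elim(2) M(2)[OF y] show "\<bar>hh \<epsilon> y\<bar> \<le> M + 1" by linarith
    qed
  qed
  with M show ?thesis by (intro that[of "M + 1"]) force+
qed

lemma remainder_term_limit:
  "uniform_limit {0<..1} (\<lambda>\<epsilon> x. x powr \<gamma> * remainder n \<epsilon> x) (\<lambda>x. 0) (at 0)"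
proof -
  obtain r where r: "0 < r" "\<And>e. \<bar>e\<bar> < r \<Longrightarrow> e \<in> V" by (rule radius_exists) blast
  obtain K where K: "0 \<le> K"
      "\<And>n \<epsilon> x. \<epsilon> \<in> V \<Longrightarrow> x \<in> {0..1} \<Longrightarrow> \<bar>Deps (g_word Tb n) \<epsilon> x\<bar> \<le> K"
    by (rule Deps_g_word_bounded) blast
  obtain c where c: "summable c" "\<And>n. 0 \<le> c n"
    "\<And>n \<epsilon> x. \<epsilon> \<in> V \<Longrightarrow> x \<in> {0<..1} \<Longrightarrow> x powr \<gamma> * \<bar>Dx (g_word Tb n \<epsilon>) x\<bar> \<le> c n"
    "\<And>n \<epsilon> x. \<epsilon> \<in> V \<Longrightarrow> x \<in> {0<..1} \<Longrightarrow> x powr \<gamma> * \<bar>Deps (\<lambda>e. Dx (g_word Tb n e)) \<epsilon> x\<bar> \<le> c n"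
    by (rule word_majorant) blast
  obtain C where C: "0 \<le> C" "\<And>\<epsilon> x. \<epsilon> \<in> V \<Longrightarrow> x \<in> {0..1} \<Longrightarrow> \<bar>Dx (g_word Tb n \<epsilon>) x\<bar> \<le> C"
    by (rule Dx_g_word_bounded) blast
  obtain L where L: "0 < L" "\<And>y. y \<in> Dlt \<Longrightarrow> \<bar>deriv_on Dlt (hh 0) y\<bar> \<le> L"
    by (rule continuous_on_Dlt_bounded[OF C1_on_Dlt_continuous_deriv[OF C1]]) blast
  obtain M where M: "0 < M" "\<forall>\<^sub>F \<epsilon> in at 0. \<forall>y\<in>Dlt. \<bar>hh \<epsilon> y\<bar> \<le> M"
    by (rule hh_bounded_near_0) blast
  obtain B where B: "0 < B"
    "\<forall>\<^sub>F t in at 0. \<forall>y\<in>Dlt. \<forall>z\<in>Dlt. \<bar>y - z\<bar> \<le> K * \<bar>t\<bar> \<longrightarrow> \<bar>hh t y - hh 0 z\<bar> \<le> B * \<bar>t\<bar>"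
    by (rule diff_quotient_bounded[OF C1 s lim K(1)]) blast
  have near: "\<forall>\<^sub>F \<epsilon> in at 0. \<bar>\<epsilon>\<bar> < r \<and> \<epsilon> \<noteq> 0"
    using r(1) by (auto simp: eventually_at dist_real_def)
  have a_lim: "uniform_limit {0<..1}
      (\<lambda>\<epsilon> x. x powr \<gamma> * ((g_word Tb n \<epsilon> x - g_word Tb n 0 x) / \<epsilon> - a_word Tb n x)) (\<lambda>x. 0) (at 0)"
    by (rule a_word_uniform_limit[OF r K(2)])
  \<comment> \<open>The constant of \<open>diff_quotient_product_bound\<close>. It depends on
    \<open>n\<close> through \<open>c n\<close> and \<open>C\<close>, which is harmless since the
    word is fixed.\<close>
  define N where "N = 2 * c n + L * C + M"
  have N: "0 < N" unfolding N_def using c(2)[of n] L(1) C(1) M(1) by (intro add_nonneg_pos) auto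
  show ?thesis
  proof (rule uniform_limitI)
    fix e :: real assume "0 < e"
    define \<eta> where "\<eta> = e / (2 * N)"
    have \<eta>: "0 < \<eta>" "\<eta> * N < e" using \<open>0 < e\<close> N by (auto simp: \<eta>_def)
    show "\<forall>\<^sub>F \<epsilon> in at 0. \<forall>x\<in>{0<..1}. dist (x powr \<gamma> * remainder n \<epsilon> x) 0 < e"
      using near diff_quotient_expansion[OF C1 s lim \<eta>(1) K(1)]
        uniform_limitD[OF a_lim \<eta>(1)]
        uniform_limitD[OF gw'_diff_B[of n, unfolded B_norm_tendsto_0_iff] \<eta>(1)]
        B(2) eventually_at_0_abs_le[OF \<eta>(1), of B] M(2)
    proof eventually_elim
      case (elim \<epsilon>)
      show ?case
      proof
        fix x :: real assume x: "x \<in> {0<..1}"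
        then have x': "x \<in> {0..1}" by simp
        have V: "\<epsilon> \<in> V" "0 \<in> V" using elim(1) r(2) nbhd(2) by auto
        note mem = g_word_mem_Dlt[OF V(1) x', of n] g_word_mem_Dlt[OF V(2) x', of n]
        have close: "\<bar>g_word Tb n \<epsilon> x - g_word Tb n 0 x\<bar> \<le> K * \<bar>\<epsilon>\<bar>"
          using elim(1) x' by (intro g_word_lipschitz[OF r(2) K(2)]) auto
        have "x powr \<gamma> * \<bar>remainder n \<epsilon> x\<bar> \<le> \<eta> * N"
          unfolding remainder_def N_def
        proof (rule diff_quotient_product_bound[where D = "(g_word Tb n \<epsilon> x - g_word Tb n 0 x) / \<epsilon>"])
          show "\<bar>(hh \<epsilon> (g_word Tb n \<epsilon> x) - hh 0 (g_word Tb n 0 x)) / \<epsilon> - s (g_word Tb n 0 x)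
              - deriv_on Dlt (hh 0) (g_word Tb n 0 x) * ((g_word Tb n \<epsilon> x - g_word Tb n 0 x) / \<epsilon>)\<bar> \<le> \<eta>"
            using elim(2) mem close by blast
          show "x powr \<gamma> * \<bar>(g_word Tb n \<epsilon> x - g_word Tb n 0 x) / \<epsilon> - a_word Tb n x\<bar> \<le> \<eta>"
            using elim(3) x by (force simp: abs_mult)
          show "x powr \<gamma> * \<bar>(Dx (g_word Tb n \<epsilon>) x - Dx (g_word Tb n 0) x) / \<epsilon> - b_word Tb n x\<bar> \<le> \<eta>"
            using elim(4) x by (force simp: abs_mult)
          have "\<bar>hh \<epsilon> (g_word Tb n \<epsilon> x) - hh 0 (g_word Tb n 0 x)\<bar> \<le> B * \<bar>\<epsilon>\<bar>"
            using elim(5) mem close by blast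
          then show "\<bar>hh \<epsilon> (g_word Tb n \<epsilon> x) - hh 0 (g_word Tb n 0 x)\<bar> \<le> \<eta>"
            using elim(6) by linarith
          show "x powr \<gamma> * \<bar>b_word Tb n x\<bar> \<le> c n"
            unfolding b_word_def by (rule c(4)[OF V(2) x])
        qed (use elim(1,7) \<eta>(1) L(2) C(2)[OF V(2) x'] mem c(3)[OF V(2) x] in auto)
        then show "dist (x powr \<gamma> * remainder n \<epsilon> x) 0 < e"
          using \<eta>(2) by (simp add: abs_mult)
      qed
    qed
  qed
qed

text \<open>Supplies the majorant for the limit under the sum and for the series in the response.
  Quotients are only bounded here, by Lipschitz estimates in \<epsilon>, so the admissible range of
  \<epsilon> does not depend on the word.\<close>

lemma response_term_bound:
  obtains d where "summable d"
    "\<And>n x. x \<in> {0<..1} \<Longrightarrow> x powr \<gamma> * \<bar>s (g_word Tb n 0 x) * Dx (g_word Tb n 0) x\<bar> \<le> d n"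
    "\<And>n x. x \<in> {0<..1} \<Longrightarrow> x powr \<gamma> * \<bar>deriv_on Dlt (hh 0) (g_word Tb n 0 x) * a_word Tb n x * Dx (g_word Tb n 0) x
        + hh 0 (g_word Tb n 0 x) * b_word Tb n x\<bar> \<le> d n"
    "\<forall>\<^sub>F \<epsilon> in at 0. \<forall>x\<in>{0<..1}. \<forall>n. x powr \<gamma> * \<bar>remainder n \<epsilon> x\<bar> \<le> d n"
proof -
  obtain r where r: "0 < r" "\<And>e. \<bar>e\<bar> < r \<Longrightarrow> e \<in> V" by (rule radius_exists) blast
  obtain K where K: "0 \<le> K"
      "\<And>n \<epsilon> x. \<epsilon> \<in> V \<Longrightarrow> x \<in> {0..1} \<Longrightarrow> \<bar>Deps (g_word Tb n) \<epsilon> x\<bar> \<le> K"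
    by (rule Deps_g_word_bounded) blast
  obtain c where c: "summable c" "\<And>n. 0 \<le> c n"
    "\<And>n \<epsilon> x. \<epsilon> \<in> V \<Longrightarrow> x \<in> {0<..1} \<Longrightarrow> x powr \<gamma> * \<bar>Dx (g_word Tb n \<epsilon>) x\<bar> \<le> c n"
    "\<And>n \<epsilon> x. \<epsilon> \<in> V \<Longrightarrow> x \<in> {0<..1} \<Longrightarrow> x powr \<gamma> * \<bar>Deps (\<lambda>e. Dx (g_word Tb n e)) \<epsilon> x\<bar> \<le> c n"
    by (rule word_majorant) blast
  obtain M where M: "0 < M" "\<forall>\<^sub>F \<epsilon> in at 0. \<forall>y\<in>Dlt. \<bar>hh \<epsilon> y\<bar> \<le> M"
      "\<And>y. y \<in> Dlt \<Longrightarrow> \<bar>hh 0 y\<bar> \<le> M"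
    by (rule hh_bounded_near_0) blast
  obtain B where B: "0 < B"
    "\<forall>\<^sub>F t in at 0. \<forall>y\<in>Dlt. \<forall>z\<in>Dlt. \<bar>y - z\<bar> \<le> K * \<bar>t\<bar> \<longrightarrow> \<bar>hh t y - hh 0 z\<bar> \<le> B * \<bar>t\<bar>"
    "\<And>z w. z \<in> Dlt \<Longrightarrow> \<bar>w\<bar> \<le> K \<Longrightarrow> \<bar>s z + deriv_on Dlt (hh 0) z * w\<bar> \<le> B"
    by (rule diff_quotient_bounded[OF C1 s lim K(1)]) blast
  have near: "\<forall>\<^sub>F \<epsilon> in at 0. \<bar>\<epsilon>\<bar> < r \<and> \<epsilon> \<noteq> 0"
    using r(1) by (auto simp: eventually_at dist_real_def)
  have V0: "0 \<in> V" by (rule nbhd(2))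
  let ?g = "\<lambda>n x. g_word Tb n 0 x" and ?v = "\<lambda>n x. Dx (g_word Tb n 0) x"
  have sB: "\<bar>s y\<bar> \<le> B" if "y \<in> Dlt" for y using B(3)[OF that, of 0] K(1) by simp
  have a: "\<bar>a_word Tb n x\<bar> \<le> K" if "x \<in> {0<..1}" for n x
    unfolding a_word_def using that by (intro K(2)[OF V0]) auto
  have b: "x powr \<gamma> * \<bar>b_word Tb n x\<bar> \<le> c n" if "x \<in> {0<..1}" for n x
    unfolding b_word_def by (rule c(4)[OF V0 that])
  have sv: "x powr \<gamma> * \<bar>s (?g n x) * ?v n x\<bar> \<le> B * c n" if x: "x \<in> {0<..1}" for n x
    using B(1) sB by (intro transfer_term_bound[OF V0 x] c(3)[OF V0 x]) auto
  have sl: "x powr \<gamma> * \<bar>(s (?g n x) + deriv_on Dlt (hh 0) (?g n x) * a_word Tb n x) * ?v n x\<bar> \<le> B * c n"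
    if x: "x \<in> {0<..1}" for n x
  proof -
    have "\<bar>s (?g n x) + deriv_on Dlt (hh 0) (?g n x) * a_word Tb n x\<bar> \<le> B"
      using x by (intro B(3) a g_word_mem_Dlt[OF V0]) auto
    then have "\<bar>s (?g n x) + deriv_on Dlt (hh 0) (?g n x) * a_word Tb n x\<bar> * (x powr \<gamma> * \<bar>?v n x\<bar>) \<le> B * c n"
      using B(1) c(3)[OF V0 x] by (intro mult_mono) auto
    then show ?thesis by (simp add: abs_mult mult_ac)
  qed
  have hb: "x powr \<gamma> * \<bar>hh 0 (?g n x) * b_word Tb n x\<bar> \<le> M * c n" if x: "x \<in> {0<..1}" for n x
    using M by (intro transfer_term_bound[OF V0 x] b[OF x]) auto
  \<comment> \<open>One coefficient for three bounds, which need \<open>B\<close>,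
    \<open>2 * B + M\<close> and \<open>2 * B + 2 * M\<close>.\<close>
  let ?d = "\<lambda>n. (3 * B + 2 * M) * c n"
  show ?thesis
  proof (rule that[of ?d])
    show "summable ?d" by (rule summable_mult[OF c(1)])
    show "x powr \<gamma> * \<bar>s (?g n x) * ?v n x\<bar> \<le> ?d n" if "x \<in> {0<..1}" for n x
    proof -
      have "B * c n \<le> ?d n" using B(1) M(1) c(2) by (intro mult_right_mono) auto
      with sv[OF that] show ?thesis by (rule order_trans)
    qed
    show "x powr \<gamma> * \<bar>deriv_on Dlt (hh 0) (?g n x) * a_word Tb n x * ?v n x + hh 0 (?g n x) * b_word Tb n x\<bar> \<le> ?d n"
      if x: "x \<in> {0<..1}" for n x
    proof -
      \<comment> \<open>The term with the derivative is the whole formal limit minus its part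
        \<open>s\<close>; \<open>B\<close> bounds both of these.\<close>
      have "\<bar>deriv_on Dlt (hh 0) (?g n x) * a_word Tb n x * ?v n x + hh 0 (?g n x) * b_word Tb n x\<bar>
          \<le> \<bar>(s (?g n x) + deriv_on Dlt (hh 0) (?g n x) * a_word Tb n x) * ?v n x\<bar>
            + \<bar>s (?g n x) * ?v n x\<bar> + \<bar>hh 0 (?g n x) * b_word Tb n x\<bar>"
        unfolding distrib_right by linarith
      then have "x powr \<gamma> * \<bar>deriv_on Dlt (hh 0) (?g n x) * a_word Tb n x * ?v n x + hh 0 (?g n x) * b_word Tb n x\<bar>
          \<le> x powr \<gamma> * (\<bar>(s (?g n x) + deriv_on Dlt (hh 0) (?g n x) * a_word Tb n x) * ?v n x\<bar>
            + \<bar>s (?g n x) * ?v n x\<bar> + \<bar>hh 0 (?g n x) * b_word Tb n x\<bar>)"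
        by (rule mult_left_mono) simp
      also have "\<dots> \<le> B * c n + B * c n + M * c n"
        unfolding distrib_left by (intro add_mono sl sv hb x)
      also have "\<dots> = (2 * B + M) * c n" by (simp add: algebra_simps)
      also have "\<dots> \<le> ?d n" using B(1) M(1) c(2) by (intro mult_right_mono) auto
      finally show ?thesis .
    qed
    show "\<forall>\<^sub>F \<epsilon> in at 0. \<forall>x\<in>{0<..1}. \<forall>n. x powr \<gamma> * \<bar>remainder n \<epsilon> x\<bar> \<le> ?d n"
      using near B(2) M(2)
    proof eventually_elim
      case (elim \<epsilon>)
      show ?case
      proof (intro ballI allI)
        fix x :: real and n assume x: "x \<in> {0<..1}"
        then have x': "x \<in> {0..1}" by simp
        have V: "\<epsilon> \<in> V" using elim(1) r(2) by auto
        have \<epsilon>: "0 < \<bar>\<epsilon>\<bar>" using elim(1) by simp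
        let ?u = "hh \<epsilon> (g_word Tb n \<epsilon> x)" and ?w = "Dx (g_word Tb n \<epsilon>) x"
        let ?p = "(?u - hh 0 (?g n x)) / \<epsilon> * ?v n x" and ?q = "?u * ((?w - ?v n x) / \<epsilon>)"
        have "\<bar>g_word Tb n \<epsilon> x - g_word Tb n 0 x\<bar> \<le> K * \<bar>\<epsilon>\<bar>"
          using elim(1) x' by (intro g_word_lipschitz[OF r(2) K(2)]) auto
        then have "\<bar>?u - hh 0 (?g n x)\<bar> \<le> B * \<bar>\<epsilon>\<bar>"
          using elim(2) g_word_mem_Dlt[OF V x'] g_word_mem_Dlt[OF V0 x'] by blast
        then have "\<bar>(?u - hh 0 (?g n x)) / \<epsilon>\<bar> \<le> B" using \<epsilon> by (simp add: pos_divide_le_eq)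
        then have "\<bar>(?u - hh 0 (?g n x)) / \<epsilon>\<bar> * (x powr \<gamma> * \<bar>?v n x\<bar>) \<le> B * c n"
          using B(1) c(3)[OF V0 x] by (intro mult_mono) auto
        then have p: "x powr \<gamma> * \<bar>?p\<bar> \<le> B * c n" by (simp add: abs_mult mult_ac)
        \<comment> \<open>At fixed \<open>x\<close> the weight is a constant and moves into the
          Lipschitz constant; multiplied back it leaves \<open>c n\<close>.\<close>
        have "\<bar>?w - ?v n x\<bar> \<le> c n / x powr \<gamma> * \<bar>\<epsilon>\<bar>"
        proof (rule Deps_lipschitz[where r = r and G = "\<lambda>e. Dx (g_word Tb n e)"])
          show "(\<lambda>e. Dx (g_word Tb n e) x) differentiable (at e)" if "\<bar>e\<bar> < r" for e
            using gw'_eps_diff r(2) that x by blast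
          show "\<bar>Deps (\<lambda>e. Dx (g_word Tb n e)) e x\<bar> \<le> c n / x powr \<gamma>" if "\<bar>e\<bar> < r" for e
            using c(4)[OF r(2)[OF that] x] x by (simp add: pos_le_divide_eq mult.commute)
        qed (use elim(1) in simp)
        then have "x powr \<gamma> * \<bar>(?w - ?v n x) / \<epsilon>\<bar> \<le> c n"
          using x \<epsilon> by (simp add: field_simps)
        then have q: "x powr \<gamma> * \<bar>?q\<bar> \<le> M * c n"
          using M(1) elim(3) by (intro transfer_term_bound[OF V x]) auto
        \<comment> \<open>Product rule for increments: \<open>?p\<close> varies the density factor,
          \<open>?q\<close> the derivative factor.\<close>
        have "remainder n \<epsilon> x = ?p + ?q
            - (s (?g n x) + deriv_on Dlt (hh 0) (?g n x) * a_word Tb n x) * ?v n x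
            - hh 0 (?g n x) * b_word Tb n x"
          using \<epsilon> unfolding remainder_def by (simp add: field_simps)
        then have "\<bar>remainder n \<epsilon> x\<bar> \<le> \<bar>?p\<bar> + \<bar>?q\<bar>
            + \<bar>(s (?g n x) + deriv_on Dlt (hh 0) (?g n x) * a_word Tb n x) * ?v n x\<bar>
            + \<bar>hh 0 (?g n x) * b_word Tb n x\<bar>"
          by linarith
        then have "x powr \<gamma> * \<bar>remainder n \<epsilon> x\<bar> \<le> x powr \<gamma> * (\<bar>?p\<bar> + \<bar>?q\<bar>
            + \<bar>(s (?g n x) + deriv_on Dlt (hh 0) (?g n x) * a_word Tb n x) * ?v n x\<bar>
            + \<bar>hh 0 (?g n x) * b_word Tb n x\<bar>)"
          by (rule mult_left_mono) simp
        also have "\<dots> \<le> B * c n + M * c n + B * c n + M * c n"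
          unfolding distrib_left by (intro add_mono p q sl hb x)
        also have "\<dots> = (2 * B + 2 * M) * c n" by (simp add: algebra_simps)
        also have "\<dots> \<le> ?d n" using B(1) c(2) by (intro mult_right_mono) auto
        finally show "x powr \<gamma> * \<bar>remainder n \<epsilon> x\<bar> \<le> ?d n" .
      qed
    qed
  qed
qed

definition response :: "real \<Rightarrow> real" where
  "response x = F_op Tb 0 s x + Q_op Tb (hh 0) x"

lemma response_bounded: "B_norm \<gamma> response < \<infinity>"
proof -
  obtain d where d: "summable d"
    "\<And>n x. x \<in> {0<..1} \<Longrightarrow> x powr \<gamma> * \<bar>s (g_word Tb n 0 x) * Dx (g_word Tb n 0) x\<bar> \<le> d n"
    "\<And>n x. x \<in> {0<..1} \<Longrightarrow> x powr \<gamma> * \<bar>deriv_on Dlt (hh 0) (g_word Tb n 0 x) * a_word Tb n x * Dx (g_word Tb n 0) x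
        + hh 0 (g_word Tb n 0 x) * b_word Tb n x\<bar> \<le> d n"
    by (rule response_term_bound) blast
  obtain M where M: "0 < M" "\<And>y. y \<in> Dlt \<Longrightarrow> \<bar>s y\<bar> \<le> M"
    by (rule continuous_on_Dlt_bounded[OF s]) blast
  have "0 \<le> d n" for n using d(2)[of 1 n] by (intro order_trans[OF abs_ge_zero]) simp
  then have d0: "0 \<le> (\<Sum>n. d n)" using d(1) by (intro suminf_nonneg) auto
  have "B_norm \<gamma> response \<le> ennreal (M + ((\<Sum>n. d n) + (\<Sum>n. d n)))"
  proof (subst B_norm_le_iff)
    show "0 \<le> M + ((\<Sum>n. d n) + (\<Sum>n. d n))" using M(1) d0 by simp
    show "\<forall>x\<in>{0<..1}. x powr \<gamma> * \<bar>response x\<bar> \<le> M + ((\<Sum>n. d n) + (\<Sum>n. d n))"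
    proof
      fix x :: real assume x: "x \<in> {0<..1}"
      show "x powr \<gamma> * \<bar>response x\<bar> \<le> M + ((\<Sum>n. d n) + (\<Sum>n. d n))"
      proof (cases "x \<in> Dlt")
        case True
        then have "response x = s x" by (simp add: response_def F_op_eq Q_op_def)
        moreover have "x powr \<gamma> \<le> 1" using x gamma_pos by (intro powr_le1) auto
        ultimately have "x powr \<gamma> * \<bar>response x\<bar> \<le> 1 * M"
          using M(2)[OF True] by (intro mult_mono) auto
        then show ?thesis using d0 by simp
      next
        case False
        have px: "0 < x powr \<gamma>" using x by simp
        have F: "x powr \<gamma> * \<bar>F_op Tb 0 s x\<bar> \<le> (\<Sum>n. d n)"
          using weighted_suminf_bound(2)[OF px d(2)[OF x] d(1)] False by (simp add: F_op_eq transfer_def)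
        have Q: "x powr \<gamma> * \<bar>Q_op Tb (hh 0) x\<bar> \<le> (\<Sum>n. d n)"
          using weighted_suminf_bound(2)[OF px d(3)[OF x] d(1)] False by (simp add: Q_op_def)
        have "x powr \<gamma> * \<bar>response x\<bar> \<le> x powr \<gamma> * (\<bar>F_op Tb 0 s x\<bar> + \<bar>Q_op Tb (hh 0) x\<bar>)"
          unfolding response_def by (intro mult_left_mono abs_triangle_ineq) simp
        also have "\<dots> \<le> (\<Sum>n. d n) + (\<Sum>n. d n)"
          unfolding distrib_left by (intro add_mono F Q)
        finally show ?thesis using M(1) by simp
      qed
    qed
  qed
  then show ?thesis by (rule le_less_trans) simp
qed

text \<open>The series for \<open>h\<close>, \<open>F_op\<close> and \<open>Q_op\<close> are shown
  to converge separately, since \<open>suminf\<close> can be split only for convergent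
  series.\<close>

lemma diff_quotient_eq_suminf:
  assumes "\<epsilon> \<in> V" "x \<in> {0<..1}" "x \<notin> Dlt"
  shows "(h \<epsilon> x - h 0 x) / \<epsilon> - response x = (\<Sum>n. remainder n \<epsilon> x)"
proof -
  have V0: "0 \<in> V" by (rule nbhd(2))
  have x: "0 < x powr \<gamma>" using assms(2) by simp
  obtain d where d: "summable d"
    "\<And>n x. x \<in> {0<..1} \<Longrightarrow> x powr \<gamma> * \<bar>s (g_word Tb n 0 x) * Dx (g_word Tb n 0) x\<bar> \<le> d n"
    "\<And>n x. x \<in> {0<..1} \<Longrightarrow> x powr \<gamma> * \<bar>deriv_on Dlt (hh 0) (g_word Tb n 0 x) * a_word Tb n x * Dx (g_word Tb n 0) x
        + hh 0 (g_word Tb n 0 x) * b_word Tb n x\<bar> \<le> d n"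
    by (rule response_term_bound) blast
  obtain c where c: "summable c" "\<And>n. 0 \<le> c n"
    "\<And>n \<epsilon> x. \<epsilon> \<in> V \<Longrightarrow> x \<in> {0<..1} \<Longrightarrow> x powr \<gamma> * \<bar>Dx (g_word Tb n \<epsilon>) x\<bar> \<le> c n"
    "\<And>n \<epsilon> x. \<epsilon> \<in> V \<Longrightarrow> x \<in> {0<..1} \<Longrightarrow> x powr \<gamma> * \<bar>Deps (\<lambda>e. Dx (g_word Tb n e)) \<epsilon> x\<bar> \<le> c n"
    by (rule word_majorant) blast
  have hsum: "(\<lambda>n. hh e (g_word Tb n e x) * Dx (g_word Tb n e) x) sums h e x" if e: "e \<in> V" for e
  proof -
    obtain M where M: "0 < M" "\<And>y. y \<in> Dlt \<Longrightarrow> \<bar>hh e y\<bar> \<le> M"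
      by (rule continuous_on_Dlt_bounded[OF hh_cont[OF e]]) blast
    have "summable (\<lambda>n. hh e (g_word Tb n e x) * Dx (g_word Tb n e) x)"
      using M by (intro weighted_suminf_bound(1)[OF x _ summable_mult[OF c(1), of M]]
          transfer_term_bound[OF e assms(2)] c(3)[OF e assms(2)]) auto
    moreover have "h e x = (\<Sum>n. hh e (g_word Tb n e x) * Dx (g_word Tb n e) x)"
      using h_eq[OF e assms(2)] assms(3) by (simp add: F_op_eq transfer_def)
    ultimately show ?thesis by (simp add: summable_sums)
  qed
  have "(\<lambda>n. s (g_word Tb n 0 x) * Dx (g_word Tb n 0) x) sums F_op Tb 0 s x"
    using weighted_suminf_bound(1)[OF x d(2)[OF assms(2)] d(1)] assms(3)
    by (simp add: F_op_eq transfer_def summable_sums)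
  moreover have "(\<lambda>n. deriv_on Dlt (hh 0) (g_word Tb n 0 x) * a_word Tb n x * Dx (g_word Tb n 0) x
        + hh 0 (g_word Tb n 0 x) * b_word Tb n x) sums Q_op Tb (hh 0) x"
    using weighted_suminf_bound(1)[OF x d(3)[OF assms(2)] d(1)] assms(3)
    by (simp add: Q_op_def summable_sums)
  ultimately have "(\<lambda>n. remainder n \<epsilon> x) sums ((h \<epsilon> x - h 0 x) / \<epsilon> - response x)"
    unfolding remainder_def response_def
    by (intro sums_diff sums_add sums_divide hsum assms(1) V0)
  then show ?thesis by (simp add: sums_iff)
qed

text \<open>On \<open>Dlt\<close> the response is \<open>s\<close> and the weight is at most
  \<open>1\<close>, so the hypothesis on \<open>hh\<close> applies directly. Off \<open>Dlt\<close>
  the error is the series of remainders, to which dominated convergence applies.\<close>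

lemma response_limit:
  "uniform_limit {0<..1} (\<lambda>\<epsilon> x. x powr \<gamma> * ((h \<epsilon> x - h 0 x) / \<epsilon> - response x)) (\<lambda>x. 0) (at 0)"
proof (rule uniform_limitI)
  fix e :: real assume e: "0 < e"
  obtain d where d: "summable d"
    "\<forall>\<^sub>F \<epsilon> in at 0. \<forall>x\<in>{0<..1}. \<forall>n. x powr \<gamma> * \<bar>remainder n \<epsilon> x\<bar> \<le> d n"
    by (rule response_term_bound) blast
  have V: "\<forall>\<^sub>F \<epsilon> in at 0. \<epsilon> \<in> V"
    using nbhd by (rule eventually_at_in_open')
  have "uniform_limit {0<..1} (\<lambda>\<epsilon> x. \<Sum>n. x powr \<gamma> * remainder n \<epsilon> x) (\<lambda>x. 0) (at 0)"
    using d by (intro uniform_limit_suminf_0 remainder_term_limit) (auto simp: abs_mult)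
  from uniform_limitD[OF this e] C0_norm_tendsto_0D[OF lim, of "e / 2"] e V d(2)
  have "\<forall>\<^sub>F \<epsilon> in at 0. (\<forall>x\<in>{0<..1}. \<bar>\<Sum>n. x powr \<gamma> * remainder n \<epsilon> x\<bar> < e) \<and>
      (\<forall>y\<in>Dlt. \<bar>(hh \<epsilon> y - hh 0 y) / \<epsilon> - s y\<bar> \<le> e / 2) \<and> \<epsilon> \<in> V \<and>
      (\<forall>x\<in>{0<..1}. \<forall>n. x powr \<gamma> * \<bar>remainder n \<epsilon> x\<bar> \<le> d n)"
    by (simp add: eventually_conj_iff)
  then show "\<forall>\<^sub>F \<epsilon> in at 0. \<forall>x\<in>{0<..1}. dist (x powr \<gamma> * ((h \<epsilon> x - h 0 x) / \<epsilon> - response x)) 0 < e"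
  proof eventually_elim
    case (elim \<epsilon>)
    show ?case
    proof
      fix x :: real assume x: "x \<in> {0<..1}"
      show "dist (x powr \<gamma> * ((h \<epsilon> x - h 0 x) / \<epsilon> - response x)) 0 < e"
      proof (cases "x \<in> Dlt")
        case True
        have "response x = s x" using True by (simp add: response_def F_op_eq Q_op_def)
        moreover have "h \<epsilon> x = hh \<epsilon> x" "h 0 x = hh 0 x"
          using True elim nbhd(2) by (auto intro: h_eq_hh)
        ultimately have "\<bar>(h \<epsilon> x - h 0 x) / \<epsilon> - response x\<bar> \<le> e / 2"
          using elim True by simp
        moreover have "x powr \<gamma> \<le> 1" using x gamma_pos by (intro powr_le1) auto
        ultimately have "x powr \<gamma> * \<bar>(h \<epsilon> x - h 0 x) / \<epsilon> - response x\<bar> \<le> 1 * (e / 2)"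
          by (intro mult_mono) auto
        then show ?thesis using e by (simp add: abs_mult)
      next
        case False
        have "summable (\<lambda>n. remainder n \<epsilon> x)"
          using elim x by (intro weighted_suminf_bound(1)[OF _ _ d(1), of "x powr \<gamma>"]) auto
        then have "x powr \<gamma> * ((h \<epsilon> x - h 0 x) / \<epsilon> - response x) = (\<Sum>n. x powr \<gamma> * remainder n \<epsilon> x)"
          using elim x False by (simp add: diff_quotient_eq_suminf suminf_mult)
        then show ?thesis using elim x by simp
      qed
    qed
  qed
qed

text \<open>Only the sum of the two operators is shown to be continuous across \<open>1/2\<close>,
  as a limit of quotients of \<open>h\<close> that are. With the weight the convergence is uniform
  up to \<open>0\<close>.\<close>

lemma continuous_on_response: "continuous_on {0<..1} response"
proof (rule continuous_on_of_weighted, rule uniform_limit_theorem[where F = "at (0::real)"])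
  have V: "\<forall>\<^sub>F \<epsilon> in at 0. \<epsilon> \<in> V"
    using nbhd by (rule eventually_at_in_open')
  then show "\<forall>\<^sub>F \<epsilon> in at 0. continuous_on {0<..1} (\<lambda>x. x powr \<gamma> * ((h \<epsilon> x - h 0 x) / \<epsilon>))"
  proof eventually_elim
    case (elim \<epsilon>)
    have "continuous_on {0<..1} (h e)" if "e \<in> V" for e
      using h_in_B_space[OF that] by (simp add: B_space_def)
    then have "continuous_on {0<..1} (\<lambda>x. x powr \<gamma> * ((h \<epsilon> x - h 0 x) * inverse \<epsilon>))"
      using elim nbhd(2) by (intro continuous_intros) auto
    then show ?case by (simp add: divide_inverse)
  qed
  show "uniform_limit {0<..1} (\<lambda>\<epsilon> x. x powr \<gamma> * ((h \<epsilon> x - h 0 x) / \<epsilon>)) (\<lambda>x. x powr \<gamma> * response x) (at 0)"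
    using response_limit unfolding uniform_limit_iff dist_real_def
    by (simp add: right_diff_distrib)
qed simp

end

end

theorem theorem3p1:
  fixes V :: "real set"
    and \<gamma> :: real
    and T :: "real \<Rightarrow> real \<Rightarrow> real"
    and Tb :: "nat \<Rightarrow> real \<Rightarrow> real \<Rightarrow> real"
    and h hh :: "real \<Rightarrow> real \<Rightarrow> real"
    and hh_star :: "real \<Rightarrow> real"
  assumes "map_family V \<gamma> T Tb h hh"
    and "C1_on_Dlt (hh 0)"
    and "continuous_on Dlt hh_star"
    and "((\<lambda>\<epsilon>. C0_norm (\<lambda>x. (hh \<epsilon> x - hh 0 x) / \<epsilon> - hh_star x)) \<longlongrightarrow> 0) (at 0)"
  shows "(\<forall>\<epsilon>\<in>V. h \<epsilon> \<in> B_space \<gamma>) \<and>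
    (\<exists>h_star \<in> B_space \<gamma>.
      ((\<lambda>\<epsilon>. B_norm \<gamma> (\<lambda>x. (h \<epsilon> x - h 0 x) / \<epsilon> - h_star x)) \<longlongrightarrow> 0) (at 0) \<and>
      (\<gamma> < 1 \<longrightarrow> ((\<lambda>\<epsilon>. L1_norm (\<lambda>x. (h \<epsilon> x - h 0 x) / \<epsilon> - h_star x)) \<longlongrightarrow> 0) (at 0)) \<and>
      (\<forall>x\<in>{0<..1}. h_star x = F_op Tb 0 hh_star x + Q_op Tb (hh 0) x))"
proof (intro conjI ballI)
  interpret map_family V \<gamma> T Tb h hh by (rule assms(1))
  show "h \<epsilon> \<in> B_space \<gamma>" if "\<epsilon> \<in> V" for \<epsilon> using that by (rule h_in_B_space)
  let ?r = "response hh_star"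
  have "?r \<in> B_space \<gamma>"
    using continuous_on_response[OF assms(2-4)] response_bounded[OF assms(2-4)]
    by (simp add: B_space_def)
  moreover have B: "((\<lambda>\<epsilon>. B_norm \<gamma> (\<lambda>x. (h \<epsilon> x - h 0 x) / \<epsilon> - ?r x)) \<longlongrightarrow> 0) (at 0)"
    unfolding B_norm_tendsto_0_iff by (rule response_limit[OF assms(2-4)])
  moreover have "((\<lambda>\<epsilon>. L1_norm (\<lambda>x. (h \<epsilon> x - h 0 x) / \<epsilon> - ?r x)) \<longlongrightarrow> 0) (at 0)" if "\<gamma> < 1"
  proof (rule tendsto_sandwich[where f = "\<lambda>_. 0"])
    show "((\<lambda>\<epsilon>. B_norm \<gamma> (\<lambda>x. (h \<epsilon> x - h 0 x) / \<epsilon> - ?r x) * ennreal (1 / (1 - \<gamma>))) \<longlongrightarrow> 0) (at 0)"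
      using ennreal_tendsto_cmult[OF _ B, of "ennreal (1 / (1 - \<gamma>))"] by (simp add: mult.commute)
    show "\<forall>\<^sub>F \<epsilon> in at 0. L1_norm (\<lambda>x. (h \<epsilon> x - h 0 x) / \<epsilon> - ?r x)
        \<le> B_norm \<gamma> (\<lambda>x. (h \<epsilon> x - h 0 x) / \<epsilon> - ?r x) * ennreal (1 / (1 - \<gamma>))"
      by (intro always_eventually allI L1_norm_le_B_norm that)
  qed auto
  moreover have "\<forall>x\<in>{0<..1}. ?r x = F_op Tb 0 hh_star x + Q_op Tb (hh 0) x"
    by (simp add: response_def[OF assms(2-4)])
  ultimately show "\<exists>h_star \<in> B_space \<gamma>.
      ((\<lambda>\<epsilon>. B_norm \<gamma> (\<lambda>x. (h \<epsilon> x - h 0 x) / \<epsilon> - h_star x)) \<longlongrightarrow> 0) (at 0) \<and>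
      (\<gamma> < 1 \<longrightarrow> ((\<lambda>\<epsilon>. L1_norm (\<lambda>x. (h \<epsilon> x - h 0 x) / \<epsilon> - h_star x)) \<longlongrightarrow> 0) (at 0)) \<and>
      (\<forall>x\<in>{0<..1}. h_star x = F_op Tb 0 hh_star x + Q_op Tb (hh 0) x)"
    by blast
qed

end
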